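(* Let $n\ge1$ and let $M\subset\mathbb{C}^{n+1}$ be an oriented smooth real hypersurface. The map $\nabla:\Gamma(\mathbb{C}TM)\times\Gamma(\mathbb{C}TM)\to\Gamma(\mathbb{C}TM)$ defined in the context is a complex connection on $M$ and satisfies the following properties: (C1) $\overline{\nabla_UV}=\nabla_{\bar U}\bar V$ for all $U,V\in\Gamma(\mathbb{C}TM)$; (C2) $\nabla_U(J(V))=J(\nabla_UV)$ for all $U\in\Gamma(\mathbb{C}TM)$ and $V\in\Gamma(\mathcal{H}\oplus\bar{\mathcal{H}})$; (C3) the bundles $\mathcal{H}$ and $\bar{\mathcal{H}}$ are parallel, i.e. for every $U\in\Gamma(\mathbb{C}TM)$, $\nabla_U$ maps $\Gamma(\mathcal{H})$ into $\Gamma(\mathcal{H})$ and $\Gamma(\bar{\mathcal{H}})$ into $\Gamma(\bar{\mathcal{H}})$; (C4) $\nabla g=0$, where $g$ is restricted to $\mathbb{C}TM$; (C5) $\mathrm{Tor}_\nabla(U,V)=0$ for all $U,V\in\Gamma(\mathcal{H})$; (C6) $\mathrm{Tor}_\nabla(U,\bar V)=-g([U,\bar V],T)\,T$ for all $U,V\in\Gamma(\mathcal{H})$.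
   Context: Setting. $J$ is the standard complex structure of $\mathbb{C}^{n+1}$ and $D$ is the standard flat connection; both are extended complex-linearly to complex vector fields. $g$ is the $\mathbb{C}$-bilinear extension of the Euclidean metric of $\mathbb{C}^{n+1}=\mathbb{R}^{2n+2}$ to complexified tangent vectors, so that $g(\partial_{z_h},\partial_{\bar z_k})=\tfrac12\delta_{hk}$ and $g(\partial_{z_h},\partial_{z_k})=g(\partial_{\bar z_h},\partial_{\bar z_k})=0$. $M$ is oriented by a smooth real unit normal $\nu$; $T=J(\nu)$ is a unit tangent vector field, and $N=\frac{1}{\sqrt2}(\nu-iT)$ is the holomorphic unit normal. $\mathbb{C}TM$ is the complexified tangent bundle, $\mathcal{H}=T^{1,0}M=T^{1,0}\mathbb{C}^{n+1}\cap\mathbb{C}TM$ is the holomorphic tangent bundle (complex rank $n$), and $\bar{\mathcal{H}}=T^{0,1}M$ is its conjugate; $\mathbb{C}TM=\mathcal{H}\oplus\bar{\mathcal{H}}\oplus\mathbb{C}T$, an orthogonal decomposition. $\Gamma(E)$ denotes smooth sections of $E$. Every $V\in\Gamma(\mathbb{C}TM)$ is uniquely $V=Z+\bar W+fT$ with $Z,W\in\Gamma(\mathcal{H})$ and $f$ a smooth complex-valued function on $M$. For $U\in\Gamma(\mathbb{C}TM)$ define $$\nabla_UV=D_UZ-g(D_UZ,\bar N)N+D_U\bar W-g(D_U\bar W,N)\bar N+(Uf)T.$$ A complex connection on $M$ means a connection on the complex vector bundle $\mathbb{C}TM$, differentiating along complex vector fields: $\nabla_UV$ is $C^\infty(M,\mathbb{C})$-linear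 in $U$, additive in $V$, and satisfies $\nabla_U(fV)=(Uf)V+f\nabla_UV$. The torsion is $\mathrm{Tor}_\nabla(U,V)=\nabla_UV-\nabla_VU-[U,V]$. *)

theory Defs
  imports "HOL-Analysis.Analysis"
begin

section \<open>Smooth maps\<close>

text \<open>
  For an open set \<open>S\<close> of a Euclidean space, \<open>C_k_on k S f\<close> says that \<open>f\<close> is of class \<open>C^k\<close> on \<open>S\<close>:
  all directional derivatives are again required to be of class \<open>C^(k-1)\<close>.
\<close>

primrec C_k_on ::
  "nat \<Rightarrow> 'a::euclidean_space set \<Rightarrow> ('a \<Rightarrow> 'b::euclidean_space) \<Rightarrow> bool" where
  "C_k_on 0 S f \<longleftrightarrow> continuous_on S f"
| "C_k_on (Suc k) S f \<longleftrightarrow>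
     (\<forall>x\<in>S. f differentiable (at x)) \<and>
     (\<forall>v. C_k_on k S (\<lambda>x. frechet_derivative f (at x) v))"

definition smooth_on_open ::
  "'a::euclidean_space set \<Rightarrow> ('a \<Rightarrow> 'b::euclidean_space) \<Rightarrow> bool" where
  "smooth_on_open S f \<longleftrightarrow> open S \<and> (\<forall>k. C_k_on k S f)"

text \<open>
  Functions and fields on a subset \<open>M\<close> are represented by total functions whose values off \<open>M\<close>
  are irrelevant. Smoothness on \<open>M\<close> is the existence of local smooth extensions.
\<close>

definition smooth_along ::
  "'a::euclidean_space set \<Rightarrow> ('a \<Rightarrow> 'b::euclidean_space) \<Rightarrow> bool" where
  "smooth_along M f \<longleftrightarrow>
     (\<forall>p\<in>M. \<exists>S h. p \<in> S \<and> smooth_on_open S h \<and> (\<forall>x\<in>M \<inter> S. h x = f x))"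


section \<open>Real hypersurfaces\<close>

definition local_defining_function ::
  "'a::euclidean_space set \<Rightarrow> 'a \<Rightarrow> 'a set \<Rightarrow> ('a \<Rightarrow> real) \<Rightarrow> bool" where
  "local_defining_function M p S \<rho> \<longleftrightarrow>
     p \<in> S \<and> smooth_on_open S \<rho> \<and> M \<inter> S = {x \<in> S. \<rho> x = 0} \<and>
     (\<forall>x\<in>S. \<exists>v. frechet_derivative \<rho> (at x) v \<noteq> 0)"

definition smooth_hypersurface :: "'a::euclidean_space set \<Rightarrow> bool" where
  "smooth_hypersurface M \<longleftrightarrow> (\<forall>p\<in>M. \<exists>S \<rho>. local_defining_function M p S \<rho>)"

text \<open>The kernel of \<open>d\<rho>\<close> at \<open>p\<close> does not depend on the local defining function \<open>\<rho>\<close>.\<close>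

definition tangent_space :: "'a::euclidean_space set \<Rightarrow> 'a \<Rightarrow> 'a set" where
  "tangent_space M p =
     {v. \<exists>S \<rho>. local_defining_function M p S \<rho> \<and> frechet_derivative \<rho> (at p) v = 0}"

definition unit_normal_field ::
  "'a::euclidean_space set \<Rightarrow> ('a \<Rightarrow> 'a) \<Rightarrow> bool" where
  "unit_normal_field M \<nu> \<longleftrightarrow>
     smooth_along M \<nu> \<and>
     (\<forall>p\<in>M. norm (\<nu> p) = 1 \<and> (\<forall>v\<in>tangent_space M p. \<nu> p \<bullet> v = 0))"


section \<open>Complexified tangent vectors\<close>

text \<open>
  The pair \<open>(X, Y)\<close> stands for the complexified tangent vector \<open>X + \<i>Y\<close>. The formal \<open>\<i>\<close> here is
  unrelated to the complex structure \<open>J\<close> of the ambient space.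
\<close>

type_synonym 'm cvec = "(complex ^ 'm) \<times> (complex ^ 'm)"
type_synonym 'm cfield = "complex ^ 'm \<Rightarrow> 'm cvec"

definition cvec_of_real :: "complex ^ 'm::finite \<Rightarrow> 'm cvec" where
  "cvec_of_real X = (X, 0)"

definition cvec_scale :: "complex \<Rightarrow> 'm::finite cvec \<Rightarrow> 'm cvec" (infixr \<open>*\<^sub>c\<close> 75) where
  "c *\<^sub>c v = (Re c *\<^sub>R fst v - Im c *\<^sub>R snd v, Re c *\<^sub>R snd v + Im c *\<^sub>R fst v)"

definition cvec_cnj :: "'m::finite cvec \<Rightarrow> 'm cvec" where
  "cvec_cnj v = (fst v, - snd v)"

definition J_real :: "complex ^ 'm::finite \<Rightarrow> complex ^ 'm" where
  "J_real X = \<i> *s X"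

definition J :: "'m::finite cvec \<Rightarrow> 'm cvec" where
  "J v = (J_real (fst v), J_real (snd v))"

text \<open>The complex bilinear (not sesquilinear) extension of the Euclidean metric.\<close>

definition g :: "'m::finite cvec \<Rightarrow> 'm cvec \<Rightarrow> complex" where
  "g v w = Complex (fst v \<bullet> fst w - snd v \<bullet> snd w) (fst v \<bullet> snd w + snd v \<bullet> fst w)"

definition ctangent_space :: "(complex ^ 'm::finite) set \<Rightarrow> complex ^ 'm \<Rightarrow> 'm cvec set" where
  "ctangent_space M p = tangent_space M p \<times> tangent_space M p"

definition type10 :: "'m::finite cvec set" where
  "type10 = {v. J v = \<i> *\<^sub>c v}"

definition hol_tangent :: "(complex ^ 'm::finite) set \<Rightarrow> complex ^ 'm \<Rightarrow> 'm cvec set" where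
  "hol_tangent M p = type10 \<inter> ctangent_space M p"

definition antihol_tangent :: "(complex ^ 'm::finite) set \<Rightarrow> complex ^ 'm \<Rightarrow> 'm cvec set" where
  "antihol_tangent M p = cvec_cnj ` hol_tangent M p"

definition levi_distribution :: "(complex ^ 'm::finite) set \<Rightarrow> complex ^ 'm \<Rightarrow> 'm cvec set" where
  "levi_distribution M p = {z + w | z w. z \<in> hol_tangent M p \<and> w \<in> antihol_tangent M p}"

definition sections ::
  "(complex ^ 'm::finite) set \<Rightarrow> (complex ^ 'm \<Rightarrow> 'm cvec set) \<Rightarrow> 'm cfield set" where
  "sections M E = {V. smooth_along M V \<and> (\<forall>p\<in>M. V p \<in> E p)}"

definition T_field :: "(complex ^ 'm::finite \<Rightarrow> complex ^ 'm) \<Rightarrow> 'm cfield" where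
  "T_field \<nu> p = J (cvec_of_real (\<nu> p))"

definition N_field :: "(complex ^ 'm::finite \<Rightarrow> complex ^ 'm) \<Rightarrow> 'm cfield" where
  "N_field \<nu> p = complex_of_real (1 / sqrt 2) *\<^sub>c (cvec_of_real (\<nu> p) - \<i> *\<^sub>c T_field \<nu> p)"


section \<open>Differentiation along complex tangent vectors\<close>

text \<open>
  The derivative within \<open>M\<close> of a map that is smooth along \<open>M\<close> is not unique as a linear map on the
  ambient space, but its restriction to \<open>tangent_space M p\<close> is: there it agrees with the
  differential of every local smooth extension. Only \<open>u \<in> ctangent_space M p\<close> is meaningful below.
\<close>

definition fun_deriv ::
  "(complex ^ 'm::finite) set \<Rightarrow> 'm cvec \<Rightarrow> (complex ^ 'm \<Rightarrow> complex) \<Rightarrow> complex ^ 'm \<Rightarrow> complex" where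
  "fun_deriv M u f p =
     frechet_derivative f (at p within M) (fst u) + \<i> * frechet_derivative f (at p within M) (snd u)"

definition D_at :: "(complex ^ 'm::finite) set \<Rightarrow> 'm cvec \<Rightarrow> 'm cfield \<Rightarrow> complex ^ 'm \<Rightarrow> 'm cvec" where
  "D_at M u V p =
     frechet_derivative V (at p within M) (fst u) + \<i> *\<^sub>c frechet_derivative V (at p within M) (snd u)"

definition app_field ::
  "(complex ^ 'm::finite) set \<Rightarrow> 'm cfield \<Rightarrow> (complex ^ 'm \<Rightarrow> complex) \<Rightarrow> complex ^ 'm \<Rightarrow> complex" where
  "app_field M U f p = fun_deriv M (U p) f p"

definition D_flat :: "(complex ^ 'm::finite) set \<Rightarrow> 'm cfield \<Rightarrow> 'm cfield \<Rightarrow> 'm cfield" where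
  "D_flat M U V p = D_at M (U p) V p"

text \<open>The Lie bracket: the tangent field acting on functions as the commutator of derivations.\<close>

definition lie_bracket :: "(complex ^ 'm::finite) set \<Rightarrow> 'm cfield \<Rightarrow> 'm cfield \<Rightarrow> 'm cfield" where
  "lie_bracket M U V p =
     (THE w. w \<in> ctangent_space M p \<and>
        (\<forall>f. smooth_along M f \<longrightarrow>
           fun_deriv M w f p = app_field M U (app_field M V f) p - app_field M V (app_field M U f) p))"


section \<open>Complex connections\<close>

text \<open>
  The first two clauses say that \<open>conn\<close> is a well-defined map from pairs of sections to sections;
  the second is needed because sections are represented by total functions.
\<close>

definition complex_connection ::
  "(complex ^ 'm::finite) set \<Rightarrow> ('m cfield \<Rightarrow> 'm cfield \<Rightarrow> 'm cfield) \<Rightarrow> bool" where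
  "complex_connection M conn \<longleftrightarrow>
     (let \<Gamma> = sections M (ctangent_space M) in
       (\<forall>U\<in>\<Gamma>. \<forall>V\<in>\<Gamma>. conn U V \<in> \<Gamma>) \<and>
       (\<forall>U\<in>\<Gamma>. \<forall>U'\<in>\<Gamma>. \<forall>V\<in>\<Gamma>. \<forall>V'\<in>\<Gamma>.
          (\<forall>p\<in>M. U p = U' p \<and> V p = V' p) \<longrightarrow> (\<forall>p\<in>M. conn U V p = conn U' V' p)) \<and>
       (\<forall>U\<in>\<Gamma>. \<forall>U'\<in>\<Gamma>. \<forall>V\<in>\<Gamma>. \<forall>p\<in>M.
          conn (\<lambda>q. U q + U' q) V p = conn U V p + conn U' V p) \<and>
       (\<forall>f. smooth_along M f \<longrightarrow> (\<forall>U\<in>\<Gamma>. \<forall>V\<in>\<Gamma>. \<forall>p\<in>M.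
          conn (\<lambda>q. f q *\<^sub>c U q) V p = f p *\<^sub>c conn U V p)) \<and>
       (\<forall>U\<in>\<Gamma>. \<forall>V\<in>\<Gamma>. \<forall>V'\<in>\<Gamma>. \<forall>p\<in>M.
          conn U (\<lambda>q. V q + V' q) p = conn U V p + conn U V' p) \<and>
       (\<forall>f. smooth_along M f \<longrightarrow> (\<forall>U\<in>\<Gamma>. \<forall>V\<in>\<Gamma>. \<forall>p\<in>M.
          conn U (\<lambda>q. f q *\<^sub>c V q) p = app_field M U f p *\<^sub>c V p + f p *\<^sub>c conn U V p)))"

definition torsion ::
  "(complex ^ 'm::finite) set \<Rightarrow> ('m cfield \<Rightarrow> 'm cfield \<Rightarrow> 'm cfield) \<Rightarrow>
    'm cfield \<Rightarrow> 'm cfield \<Rightarrow> 'm cfield" where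
  "torsion M conn U V p = conn U V p - conn V U p - lie_bracket M U V p"

definition cov_deriv_g ::
  "(complex ^ 'm::finite) set \<Rightarrow> ('m cfield \<Rightarrow> 'm cfield \<Rightarrow> 'm cfield) \<Rightarrow>
    'm cfield \<Rightarrow> 'm cfield \<Rightarrow> 'm cfield \<Rightarrow> complex ^ 'm \<Rightarrow> complex" where
  "cov_deriv_g M conn U V W p =
     app_field M U (\<lambda>q. g (V q) (W q)) p - g (conn U V p) (W p) - g (V p) (conn U W p)"


section \<open>The connection of an oriented hypersurface\<close>

definition split_at ::
  "(complex ^ 'm::finite) set \<Rightarrow> (complex ^ 'm \<Rightarrow> complex ^ 'm) \<Rightarrow> complex ^ 'm \<Rightarrow> 'm cvec \<Rightarrow>
    'm cvec \<times> 'm cvec \<times> complex" where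
  "split_at M \<nu> p v =
     (THE (z, w, c). z \<in> hol_tangent M p \<and> w \<in> hol_tangent M p \<and>
        v = z + cvec_cnj w + c *\<^sub>c T_field \<nu> p)"

definition nabla ::
  "(complex ^ 'm::finite) set \<Rightarrow> (complex ^ 'm \<Rightarrow> complex ^ 'm) \<Rightarrow>
    'm cfield \<Rightarrow> 'm cfield \<Rightarrow> 'm cfield" where
  "nabla M \<nu> U V =
     (let Z = (\<lambda>q. fst (split_at M \<nu> q (V q)));
          W = (\<lambda>q. fst (snd (split_at M \<nu> q (V q))));
          Wc = (\<lambda>q. cvec_cnj (W q));
          f = (\<lambda>q. snd (snd (split_at M \<nu> q (V q))));
          N = N_field \<nu>;
          Nc = (\<lambda>q. cvec_cnj (N q))
      in (\<lambda>p. D_flat M U Z p - g (D_flat M U Z p) (Nc p) *\<^sub>c N p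
            + D_flat M U Wc p - g (D_flat M U Wc p) (N p) *\<^sub>c Nc p
            + app_field M U f p *\<^sub>c T_field \<nu> p))"

end

(*
  A field V = Z + B + f T, with Z of type (1,0), B of type (0,1) and both tangent to M, has
  nabla_U V = P (D_U Z) + P' (D_U B) + (U f) T, where P and P' remove the components along N and
  its conjugate. As D commutes with J, P (D_U Z) is again tangent of type (1,0); as N is orthogonal
  to all tangent vectors, the connection axioms, reality and metric compatibility reduce to the
  product rules for D. The bracket [U,V] is D_U V - D_V U by symmetry of second derivatives, and
  its tangency to M gives both torsion identities.
*)

theory Submission
  imports Defs
begin

section \<open>Smooth maps\<close>

text \<open>Fields are known on \<open>M\<close> only, and off the tangent space
  \<open>frechet_derivative\<close> within \<open>M\<close> is an arbitrary choice. The analytic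
  part shows that its values on tangent vectors are forced; only then can product rules and
  smoothness of \<open>D_U V\<close> be derived. The splitting and the bracket are definite
  descriptions, so each needs existence and uniqueness.

  A vector of type (1,0) is orthogonal to N for free. As \<nu> is a combination of N and conj N,
  such a vector is tangent once its product with conj N vanishes, and subtracting one multiple of N
  achieves this because g(N, conj N) = 1.

  Metric compatibility works because g pairs H only with conj H, and T is parallel by construction.
  For the mixed torsion let w = [U, conj V]. The derivative of conj V along U has type (0,1) and
  that of U along conj V has type (1,0), so the two removed coefficients are, up to sign, g(w, N)
  and g(w, conj N). Since g(w, \<nu>) = 0, both are multiples of g(w, T), and the terms combine to
  -g(w, T) T, the factor being (i / sqrt 2) (2 i / sqrt 2) = -1.\<close>

lemma C_k_on_SucD: "C_k_on (Suc k) S f \<Longrightarrow> C_k_on k S f"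
proof (induction k arbitrary: f)
  case 0
  then show ?case
    by (auto intro!: continuous_at_imp_continuous_on differentiable_imp_continuous_within)
next
  case (Suc k)
  then show ?case by (metis C_k_on.simps(2))
qed

lemma C_k_on_subset: "C_k_on k S f \<Longrightarrow> T \<subseteq> S \<Longrightarrow> C_k_on k T f"
  by (induction k arbitrary: f) (auto intro: continuous_on_subset)

text \<open>Differentiability and the derivative at a point of the open set \<open>S\<close> depend
  only on values in \<open>S\<close>. This lifts each pointwise formula for a derivative below to a
  statement about differentiability classes.\<close>

lemma C_k_on_cong:
  assumes "open S" "\<And>x. x \<in> S \<Longrightarrow> f x = h x" "C_k_on k S f"
  shows "C_k_on k S h"
  using assms(2,3)
proof (induction k arbitrary: f h)
  case 0
  then show ?case by (metis C_k_on.simps(1) continuous_on_cong)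
next
  case (Suc k)
  have der: "frechet_derivative f (at x) = frechet_derivative h (at x)"
    "h differentiable at x" if "x \<in> S" for x
  proof -
    have f: "(f has_derivative frechet_derivative f (at x)) (at x)"
      using Suc.prems that by (simp add: frechet_derivative_works)
    have "(h has_derivative frechet_derivative f (at x)) (at x)"
      by (rule has_derivative_transform_within_open[OF f \<open>open S\<close> that]) (rule Suc.prems(1))
    then show "frechet_derivative f (at x) = frechet_derivative h (at x)" "h differentiable at x"
      by (auto simp: frechet_derivative_at differentiableI)
  qed
  have "C_k_on k S (\<lambda>x. frechet_derivative h (at x) v)" for v
    by (rule Suc.IH[of "\<lambda>x. frechet_derivative f (at x) v"]) (use Suc.prems der in auto)
  with der show ?case by simp
qed

lemma C_k_on_const: "C_k_on k S (\<lambda>x. c)"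
  by (induction k arbitrary: c) auto

lemma C_k_on_ident: "C_k_on k S (\<lambda>x. x)"
  by (cases k) (auto intro: C_k_on_const)

lemma C_k_on_add:
  assumes "open S" "C_k_on k S f" "C_k_on k S h"
  shows "C_k_on k S (\<lambda>x. f x + h x)"
  using assms(2,3)
proof (induction k arbitrary: f h)
  case 0
  then show ?case by (simp add: continuous_on_add)
next
  case (Suc k)
  have der: "((\<lambda>x. f x + h x) has_derivative
      (\<lambda>v. frechet_derivative f (at x) v + frechet_derivative h (at x) v)) (at x)"
    if "x \<in> S" for x
    using Suc.prems that by (intro has_derivative_add) (auto simp: frechet_derivative_works)
  have "C_k_on k S (\<lambda>x. frechet_derivative (\<lambda>x. f x + h x) (at x) v)" for v
    by (rule C_k_on_cong[OF \<open>open S\<close> _ Suc.IH[of "\<lambda>x. frechet_derivative f (at x) v"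
            "\<lambda>x. frechet_derivative h (at x) v"]])
      (use Suc.prems frechet_derivative_at[OF der] in \<open>auto simp: fun_eq_iff\<close>)
  with der show ?case by (auto simp: differentiable_def)
qed

lemma C_k_on_sum:
  assumes "open S" "\<And>i. i \<in> I \<Longrightarrow> C_k_on k S (f i)"
  shows "C_k_on k S (\<lambda>x. \<Sum>i\<in>I. f i x)"
  using assms(2)
  by (induction I rule: infinite_finite_induct) (auto intro!: C_k_on_const C_k_on_add assms(1))

lemma C_k_on_bounded_linear:
  assumes "open S" "bounded_linear L" "C_k_on k S f"
  shows "C_k_on k S (\<lambda>x. L (f x))"
  using assms(3)
proof (induction k arbitrary: f)
  case 0
  then show ?case by (simp add: bounded_linear.continuous_on[OF assms(2)])
next
  case (Suc k)
  have der: "((\<lambda>x. L (f x)) has_derivative (\<lambda>v. L (frechet_derivative f (at x) v))) (at x)"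
    if "x \<in> S" for x
    using Suc.prems that
    by (intro bounded_linear.has_derivative[OF assms(2)]) (auto simp: frechet_derivative_works)
  have "C_k_on k S (\<lambda>x. frechet_derivative (\<lambda>x. L (f x)) (at x) v)" for v
    by (rule C_k_on_cong[OF \<open>open S\<close> _ Suc.IH[of "\<lambda>x. frechet_derivative f (at x) v"]])
      (use Suc.prems frechet_derivative_at[OF der] in \<open>auto simp: fun_eq_iff\<close>)
  with der show ?case by (auto simp: differentiable_def)
qed

text \<open>The Leibniz rule leaves one factor undifferentiated in each summand; the induction needs
  that factor in the lower class, which \<open>C_k_on_SucD\<close> supplies.\<close>

lemma C_k_on_bounded_bilinear:
  assumes "open S" "bounded_bilinear B" "C_k_on k S f" "C_k_on k S h"
  shows "C_k_on k S (\<lambda>x. B (f x) (h x))"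
  using assms(3,4)
proof (induction k arbitrary: f h)
  case 0
  then show ?case by (simp add: bounded_bilinear.continuous_on[OF assms(2)])
next
  case (Suc k)
  have der: "((\<lambda>x. B (f x) (h x)) has_derivative
      (\<lambda>v. B (f x) (frechet_derivative h (at x) v) + B (frechet_derivative f (at x) v) (h x))) (at x)"
    if "x \<in> S" for x
    using Suc.prems that
    by (intro bounded_bilinear.FDERIV[OF assms(2)]) (auto simp: frechet_derivative_works)
  have "C_k_on k S (\<lambda>x. B (f x) (frechet_derivative h (at x) v) +
                        B (frechet_derivative f (at x) v) (h x))" for v
    using Suc.prems C_k_on_SucD[OF Suc.prems(1)] C_k_on_SucD[OF Suc.prems(2)]
    by (intro C_k_on_add Suc.IH assms(1)) auto
  then have "C_k_on k S (\<lambda>x. frechet_derivative (\<lambda>x. B (f x) (h x)) (at x) v)" for v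
    by (rule C_k_on_cong[OF \<open>open S\<close>, rotated])
      (use frechet_derivative_at[OF der] in \<open>auto simp: fun_eq_iff\<close>)
  with der show ?case by (auto simp: differentiable_def)
qed

lemma smooth_on_open_has_derivative:
  assumes "smooth_on_open S h" "x \<in> S"
  shows "(h has_derivative frechet_derivative h (at x)) (at x)"
proof -
  have "C_k_on 1 S h" using assms by (simp add: smooth_on_open_def)
  with assms(2) show ?thesis by (simp add: frechet_derivative_works)
qed

lemma smooth_on_open_subset:
  "smooth_on_open S h \<Longrightarrow> open T \<Longrightarrow> T \<subseteq> S \<Longrightarrow> smooth_on_open T h"
  by (auto simp: smooth_on_open_def intro: C_k_on_subset)

lemma smooth_on_open_derivative:
  assumes "smooth_on_open S h"
  shows "smooth_on_open S (\<lambda>x. frechet_derivative h (at x) v)"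
proof -
  have "C_k_on (Suc k) S h" for k using assms by (simp add: smooth_on_open_def)
  then show ?thesis using assms by (simp add: smooth_on_open_def)
qed

text \<open>\<open>C_k_on\<close> differentiates in fixed directions only. Expanding the moving
  direction \<open>X x\<close> over \<open>Basis\<close> gives a finite sum of products of smooth
  functions.\<close>

lemma smooth_on_open_derivative_along:
  assumes h: "smooth_on_open S h" and X: "smooth_on_open S X"
  shows "smooth_on_open S (\<lambda>x. frechet_derivative h (at x) (X x))"
proof -
  have S: "open S" using h by (simp add: smooth_on_open_def)
  have "C_k_on k S (\<lambda>x. \<Sum>b\<in>Basis. (X x \<bullet> b) *\<^sub>R frechet_derivative h (at x) b)" for k
    using X smooth_on_open_derivative[OF h]
    by (intro C_k_on_sum C_k_on_bounded_bilinear[OF S bounded_bilinear_scaleR]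
        C_k_on_bounded_linear[OF S bounded_linear_inner_left] S) (auto simp: smooth_on_open_def)
  then have "C_k_on k S (\<lambda>x. frechet_derivative h (at x) (X x))" for k
  proof (rule C_k_on_cong[OF S, rotated])
    fix x assume "x \<in> S"
    interpret linear "frechet_derivative h (at x)"
      using smooth_on_open_has_derivative[OF h \<open>x \<in> S\<close>] by (rule has_derivative_linear)
    have "frechet_derivative h (at x) (\<Sum>b\<in>Basis. (X x \<bullet> b) *\<^sub>R b) =
        (\<Sum>b\<in>Basis. (X x \<bullet> b) *\<^sub>R frechet_derivative h (at x) b)"
      by (simp add: sum scale)
    then show "(\<Sum>b\<in>Basis. (X x \<bullet> b) *\<^sub>R frechet_derivative h (at x) b) =
        frechet_derivative h (at x) (X x)"
      by (simp add: euclidean_representation)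
  qed
  then show ?thesis using S by (simp add: smooth_on_open_def)
qed

section \<open>Functions smooth along a subset\<close>

lemma smooth_alongE:
  assumes "smooth_along M f" "p \<in> M"
  obtains S h where "p \<in> S" "smooth_on_open S h" "\<And>x. x \<in> M \<Longrightarrow> x \<in> S \<Longrightarrow> h x = f x"
  using assms unfolding smooth_along_def by (metis IntI)

lemma smooth_along_cong:
  assumes "smooth_along M f" "\<And>x. x \<in> M \<Longrightarrow> f x = h x"
  shows "smooth_along M h"
  using assms unfolding smooth_along_def by (metis IntD1)

lemma smooth_along_const: "smooth_along M (\<lambda>x. c)"
  unfolding smooth_along_def smooth_on_open_def using C_k_on_const open_UNIV by blast

lemma smooth_along_ident: "smooth_along M (\<lambda>x. x)"
  unfolding smooth_along_def smooth_on_open_def using C_k_on_ident open_UNIV by blast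

lemma smooth_along_bounded_linear:
  assumes "bounded_linear L" "smooth_along M f"
  shows "smooth_along M (\<lambda>x. L (f x))"
  unfolding smooth_along_def
proof
  fix p assume "p \<in> M"
  then obtain S h where
    "p \<in> S" "smooth_on_open S h" "\<And>x. x \<in> M \<Longrightarrow> x \<in> S \<Longrightarrow> h x = f x"
    using smooth_alongE[OF assms(2)] by blast
  with assms(1) show "\<exists>S h. p \<in> S \<and> smooth_on_open S h \<and> (\<forall>x\<in>M \<inter> S. h x = L (f x))"
    by (intro exI[of _ S] exI[of _ "\<lambda>x. L (h x)"])
      (auto simp: smooth_on_open_def intro: C_k_on_bounded_linear)
qed

lemma smooth_along_common_extension:
  assumes "smooth_along M f" "smooth_along M f'" "p \<in> M"
  obtains S h h' where "p \<in> S" "smooth_on_open S h" "smooth_on_open S h'"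
    "\<And>x. x \<in> M \<Longrightarrow> x \<in> S \<Longrightarrow> h x = f x" "\<And>x. x \<in> M \<Longrightarrow> x \<in> S \<Longrightarrow> h' x = f' x"
proof -
  obtain S h where 1: "p \<in> S" "smooth_on_open S h" "\<And>x. x \<in> M \<Longrightarrow> x \<in> S \<Longrightarrow> h x = f x"
    using smooth_alongE[OF assms(1,3)] by blast
  obtain S' h' where 2: "p \<in> S'" "smooth_on_open S' h'" "\<And>x. x \<in> M \<Longrightarrow> x \<in> S' \<Longrightarrow> h' x = f' x"
    using smooth_alongE[OF assms(2,3)] by blast
  have "open (S \<inter> S')" using 1 2 by (auto simp: smooth_on_open_def)
  with 1 2 show thesis
    by (intro that[of "S \<inter> S'" h h']) (auto intro: smooth_on_open_subset)
qed

lemma smooth_along_add: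
  assumes "smooth_along M f" "smooth_along M f'"
  shows "smooth_along M (\<lambda>x. f x + f' x)"
  unfolding smooth_along_def
proof
  fix p assume "p \<in> M"
  with assms obtain S h h' where "p \<in> S" "smooth_on_open S h" "smooth_on_open S h'"
    "\<And>x. x \<in> M \<Longrightarrow> x \<in> S \<Longrightarrow> h x = f x" "\<And>x. x \<in> M \<Longrightarrow> x \<in> S \<Longrightarrow> h' x = f' x"
    using smooth_along_common_extension by blast
  then show "\<exists>S h. p \<in> S \<and> smooth_on_open S h \<and> (\<forall>x\<in>M \<inter> S. h x = f x + f' x)"
    by (intro exI[of _ S] exI[of _ "\<lambda>x. h x + h' x"])
      (auto simp: smooth_on_open_def intro: C_k_on_add)
qed

lemma smooth_along_bounded_bilinear:
  assumes "bounded_bilinear B" "smooth_along M f" "smooth_along M f'"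
  shows "smooth_along M (\<lambda>x. B (f x) (f' x))"
  unfolding smooth_along_def
proof
  fix p assume "p \<in> M"
  with assms obtain S h h' where "p \<in> S" "smooth_on_open S h" "smooth_on_open S h'"
    "\<And>x. x \<in> M \<Longrightarrow> x \<in> S \<Longrightarrow> h x = f x" "\<And>x. x \<in> M \<Longrightarrow> x \<in> S \<Longrightarrow> h' x = f' x"
    using smooth_along_common_extension by blast
  with assms(1) show "\<exists>S h. p \<in> S \<and> smooth_on_open S h \<and> (\<forall>x\<in>M \<inter> S. h x = B (f x) (f' x))"
    by (intro exI[of _ S] exI[of _ "\<lambda>x. B (h x) (h' x)"])
      (auto simp: smooth_on_open_def intro: C_k_on_bounded_bilinear)
qed

lemma smooth_along_diff:
  assumes "smooth_along M f" "smooth_along M f'"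
  shows "smooth_along M (\<lambda>x. f x - f' x)"
  using smooth_along_add[OF assms(1)
      smooth_along_bounded_linear[OF bounded_linear_minus[OF bounded_linear_ident] assms(2)]]
  by simp

section \<open>Symmetry of second derivatives\<close>

lemma mean_value_along:
  fixes f :: "'a::real_normed_vector \<Rightarrow> real"
  assumes "t > 0"
    and "\<And>s. 0 \<le> s \<Longrightarrow> s \<le> t \<Longrightarrow> (f has_derivative f' (p + s *\<^sub>R a)) (at (p + s *\<^sub>R a))"
  obtains s where "0 < s" "s < t" "f (p + t *\<^sub>R a) - f p = t * f' (p + s *\<^sub>R a) a"
proof -
  have "DERIV (\<lambda>s. f (p + s *\<^sub>R a)) s :> f' (p + s *\<^sub>R a) a" if "0 \<le> s" "s \<le> t" for s
  proof -
    have "((\<lambda>s. f (p + s *\<^sub>R a)) has_derivative (\<lambda>r. f' (p + s *\<^sub>R a) (r *\<^sub>R a))) (at s)"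
      by (rule has_derivative_compose[where f = "\<lambda>s. p + s *\<^sub>R a", OF _ assms(2)[OF that]])
        (auto intro!: derivative_eq_intros)
    moreover have "(\<lambda>r. f' (p + s *\<^sub>R a) (r *\<^sub>R a)) = (*) (f' (p + s *\<^sub>R a) a)"
      using has_derivative_linear[OF assms(2)[OF that]] by (auto simp: linear_cmul mult.commute)
    ultimately show ?thesis by (simp add: has_field_derivative_def)
  qed
  from MVT2[OF \<open>t > 0\<close> this] that show thesis by auto
qed

text \<open>
  The left-hand side is symmetric in \<open>a\<close> and \<open>b\<close>, so \<open>t \<rightarrow> 0\<close> gives the symmetry of second derivatives.
\<close>

lemma second_difference_mean_value:
  fixes h :: "'a::euclidean_space \<Rightarrow> real"
  assumes h: "smooth_on_open S h" and t: "t > 0"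
    and S: "\<And>r s. 0 \<le> r \<Longrightarrow> r \<le> t \<Longrightarrow> 0 \<le> s \<Longrightarrow> s \<le> t \<Longrightarrow> p + r *\<^sub>R a + s *\<^sub>R b \<in> S"
  obtains r s where "0 < r" "r < t" "0 < s" "s < t"
    "h (p + t *\<^sub>R a + t *\<^sub>R b) - h (p + t *\<^sub>R a) - h (p + t *\<^sub>R b) + h p =
      t * (t * frechet_derivative (\<lambda>x. frechet_derivative h (at x) a) (at (p + r *\<^sub>R a + s *\<^sub>R b)) b)"
proof -
  let ?d = "\<lambda>x. frechet_derivative h (at x)"
  \<comment> \<open>The second difference is the increment of \<open>?\<phi>\<close> from
    \<open>p\<close> to \<open>p + t *\<^sub>R a\<close>. The mean value theorem in direction
    \<open>a\<close> turns it into an increment of the \<open>a\<close>-derivative in direction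
    \<open>b\<close>, to which the theorem is applied once more.\<close>
  let ?\<phi> = "\<lambda>x. h (x + t *\<^sub>R b) - h x"
  have "(?\<phi> has_derivative (\<lambda>v. ?d (p + r *\<^sub>R a + t *\<^sub>R b) v - ?d (p + r *\<^sub>R a) v)) (at (p + r *\<^sub>R a))"
    if r: "0 \<le> r" "r \<le> t" for r
  proof (rule has_derivative_diff)
    show "(h has_derivative ?d (p + r *\<^sub>R a)) (at (p + r *\<^sub>R a))"
      using smooth_on_open_has_derivative[OF h S[of r 0]] r t by simp
    have "(h has_derivative ?d (p + r *\<^sub>R a + t *\<^sub>R b)) (at (p + r *\<^sub>R a + t *\<^sub>R b))"
      using smooth_on_open_has_derivative[OF h S[of r t]] r t by simp
    then show "((\<lambda>x. h (x + t *\<^sub>R b)) has_derivative ?d (p + r *\<^sub>R a + t *\<^sub>R b)) (at (p + r *\<^sub>R a))"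
      by (rule has_derivative_compose[rotated]) (auto intro!: derivative_eq_intros)
  qed
  then obtain r where r: "0 < r" "r < t"
    and 1: "?\<phi> (p + t *\<^sub>R a) - ?\<phi> p = t * (?d (p + r *\<^sub>R a + t *\<^sub>R b) a - ?d (p + r *\<^sub>R a) a)"
    using mean_value_along[OF t, of ?\<phi> "\<lambda>x v. ?d (x + t *\<^sub>R b) v - ?d x v" p a] by blast
  have "((\<lambda>x. ?d x a) has_derivative frechet_derivative (\<lambda>x. ?d x a) (at (p + r *\<^sub>R a + s *\<^sub>R b)))
      (at (p + r *\<^sub>R a + s *\<^sub>R b))" if "0 \<le> s" "s \<le> t" for s
    using smooth_on_open_has_derivative[OF smooth_on_open_derivative[OF h] S[of r s]] r that by simp
  then obtain s where s: "0 < s" "s < t"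
    and 2: "?d (p + r *\<^sub>R a + t *\<^sub>R b) a - ?d (p + r *\<^sub>R a) a =
      t * frechet_derivative (\<lambda>x. ?d x a) (at (p + r *\<^sub>R a + s *\<^sub>R b)) b"
    using mean_value_along[OF t, of "\<lambda>x. ?d x a" "\<lambda>y. frechet_derivative (\<lambda>x. ?d x a) (at y)"
        "p + r *\<^sub>R a" b] by blast
  show thesis
    by (rule that[OF r s]) (use 1 2 in \<open>simp add: algebra_simps\<close>)
qed

lemma symmetric_second_derivative_real:
  fixes h :: "'a::euclidean_space \<Rightarrow> real"
  assumes h: "smooth_on_open S h" and p: "p \<in> S"
  shows "frechet_derivative (\<lambda>x. frechet_derivative h (at x) a) (at p) b =
    frechet_derivative (\<lambda>x. frechet_derivative h (at x) b) (at p) a"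
proof -
  let ?D = "\<lambda>a b x. frechet_derivative (\<lambda>x. frechet_derivative h (at x) a) (at x) b"
  have S: "open S" using h by (simp add: smooth_on_open_def)
  have cont: "continuous_on S (?D a b)" for a b
  proof -
    have "C_k_on 0 S (?D a b)"
      using smooth_on_open_derivative[OF smooth_on_open_derivative[OF h], of a b]
      unfolding smooth_on_open_def by blast
    then show ?thesis by simp
  qed
  have "\<bar>?D a b p - ?D b a p\<bar> \<le> e" if "e > 0" for e
  proof -
    have ev: "\<forall>\<^sub>F x in nhds p. \<bar>?D a b x - ?D a b p\<bar> < e / 2" for a b
    proof -
      have "isCont (?D a b) p" using cont S p by (simp add: continuous_on_eq_continuous_at)
      then have "(?D a b \<longlongrightarrow> ?D a b p) (nhds p)"
        using tendsto_at_iff_tendsto_nhds[of "?D a b" p] by (simp only: isCont_def)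
      then have "\<forall>\<^sub>F x in nhds p. dist (?D a b x) (?D a b p) < e / 2"
        using \<open>e > 0\<close> by (intro tendstoD) simp_all
      then show ?thesis by (simp add: dist_real_def)
    qed
    have "\<forall>\<^sub>F x in nhds p. x \<in> S \<and> \<bar>?D a b x - ?D a b p\<bar> < e / 2 \<and> \<bar>?D b a x - ?D b a p\<bar> < e / 2"
      by (intro eventually_conj ev eventually_nhds_in_open S p)
    then obtain d where d: "d > 0" and near: "\<And>x. dist x p < d \<Longrightarrow>
        x \<in> S \<and> \<bar>?D a b x - ?D a b p\<bar> < e / 2 \<and> \<bar>?D b a x - ?D b a p\<bar> < e / 2"
      unfolding eventually_nhds_metric by blast
    \<comment> \<open>The parallelogram spanned by \<open>t *\<^sub>R a\<close> and
      \<open>t *\<^sub>R b\<close> at \<open>p\<close> then lies in the ball of radius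
      \<open>d\<close>; the summand 1 keeps the denominator positive when \<open>a\<close> and
      \<open>b\<close> vanish.\<close>
    define t where "t = d / (2 * (norm a + norm b + 1))"
    have pos: "0 < norm a + norm b + 1" by (smt (verit) norm_ge_zero)
    have t: "t > 0" unfolding t_def using d pos by simp
    have small: "dist (p + r *\<^sub>R a + s *\<^sub>R b) p < d" if "0 \<le> r" "r \<le> t" "0 \<le> s" "s \<le> t" for r s
    proof -
      have "dist (p + r *\<^sub>R a + s *\<^sub>R b) p = norm (r *\<^sub>R a + s *\<^sub>R b)" by (simp add: dist_norm)
      also have "\<dots> \<le> r * norm a + s * norm b"
        using norm_triangle_ineq[of "r *\<^sub>R a" "s *\<^sub>R b"] that by simp
      also have "\<dots> \<le> t * norm a + t * norm b"
        using that by (intro add_mono mult_right_mono) auto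
      also have "\<dots> < t * (2 * (norm a + norm b + 1))"
        using t pos by (simp add: algebra_simps add_pos_nonneg add_nonneg_pos)
      also have "\<dots> = d" unfolding t_def using pos by simp
      finally show ?thesis .
    qed
    let ?\<Delta> = "h (p + t *\<^sub>R a + t *\<^sub>R b) - h (p + t *\<^sub>R a) - h (p + t *\<^sub>R b) + h p"
    obtain r s where rs: "0 < r" "r < t" "0 < s" "s < t"
      and 1: "?\<Delta> = t * (t * ?D a b (p + r *\<^sub>R a + s *\<^sub>R b))"
      using second_difference_mean_value[OF h t, of p a b] near small by metis
    have "p + r *\<^sub>R b + s *\<^sub>R a \<in> S" if "0 \<le> r" "r \<le> t" "0 \<le> s" "s \<le> t" for r s
      using near[OF small[of s r]] that by (simp add: add.commute add.left_commute)
    then obtain r' s' where rs': "0 < r'" "r' < t" "0 < s'" "s' < t"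
      and 2: "h (p + t *\<^sub>R b + t *\<^sub>R a) - h (p + t *\<^sub>R b) - h (p + t *\<^sub>R a) + h p =
        t * (t * ?D b a (p + r' *\<^sub>R b + s' *\<^sub>R a))"
      using second_difference_mean_value[OF h t, of p b a] by metis
    \<comment> \<open>The two readings of the same second difference equate the two mixed
      derivatives at two different points, each within \<open>e / 2\<close> of its value at
      \<open>p\<close>.\<close>
    have "h (p + t *\<^sub>R b + t *\<^sub>R a) = h (p + t *\<^sub>R a + t *\<^sub>R b)" by (simp add: ac_simps)
    with 2 have "?\<Delta> = t * (t * ?D b a (p + r' *\<^sub>R b + s' *\<^sub>R a))" by linarith
    with 1 t have "?D a b (p + r *\<^sub>R a + s *\<^sub>R b) = ?D b a (p + r' *\<^sub>R b + s' *\<^sub>R a)" by simp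
    moreover have "\<bar>?D a b (p + r *\<^sub>R a + s *\<^sub>R b) - ?D a b p\<bar> < e / 2"
      using near[OF small[of r s]] rs by simp
    moreover have "\<bar>?D b a (p + r' *\<^sub>R b + s' *\<^sub>R a) - ?D b a p\<bar> < e / 2"
      using near[OF small[of s' r']] rs' by (simp add: add.commute add.left_commute)
    ultimately show ?thesis by linarith
  qed
  then show ?thesis using field_le_epsilon[of "\<bar>?D a b p - ?D b a p\<bar>" 0] by simp
qed

text \<open>The mean value theorem needs real values, so the real case is applied to each component
  \<open>h x \<bullet> e\<close>.\<close>

lemma symmetric_second_derivative:
  fixes h :: "'a::euclidean_space \<Rightarrow> 'b::euclidean_space"
  assumes h: "smooth_on_open S h" and p: "p \<in> S"
  shows "frechet_derivative (\<lambda>x. frechet_derivative h (at x) a) (at p) b =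
    frechet_derivative (\<lambda>x. frechet_derivative h (at x) b) (at p) a"
proof (rule euclidean_eqI)
  fix e :: 'b
  have S: "open S" using h by (simp add: smooth_on_open_def)
  have he: "smooth_on_open S (\<lambda>x. h x \<bullet> e)"
    using h C_k_on_bounded_linear[OF S bounded_linear_inner_left, of _ h e]
    by (auto simp: smooth_on_open_def)
  have *: "frechet_derivative (\<lambda>x. f x \<bullet> e) (at x) = (\<lambda>v. frechet_derivative f (at x) v \<bullet> e)"
    if "smooth_on_open S f" "x \<in> S" for f :: "'a \<Rightarrow> 'b" and x
    using has_derivative_inner_left[OF smooth_on_open_has_derivative[OF that], of e]
    by (rule frechet_derivative_at[symmetric])
  have "frechet_derivative (\<lambda>x. frechet_derivative (\<lambda>x. h x \<bullet> e) (at x) a) (at p) b =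
      frechet_derivative (\<lambda>x. frechet_derivative h (at x) a) (at p) b \<bullet> e" for a b
  proof -
    have "((\<lambda>x. frechet_derivative h (at x) a \<bullet> e) has_derivative
        (\<lambda>v. frechet_derivative (\<lambda>x. frechet_derivative h (at x) a) (at p) v \<bullet> e)) (at p)"
      by (intro has_derivative_inner_left smooth_on_open_has_derivative[OF _ p]
          smooth_on_open_derivative h)
    then have "((\<lambda>x. frechet_derivative (\<lambda>x. h x \<bullet> e) (at x) a) has_derivative
        (\<lambda>v. frechet_derivative (\<lambda>x. frechet_derivative h (at x) a) (at p) v \<bullet> e)) (at p)"
      by (rule has_derivative_transform_within_open[OF _ S p]) (simp add: *[OF h])
    then show ?thesis by (metis frechet_derivative_at)
  qed
  with symmetric_second_derivative_real[OF he p, of a b]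
  show "frechet_derivative (\<lambda>x. frechet_derivative h (at x) a) (at p) b \<bullet> e =
      frechet_derivative (\<lambda>x. frechet_derivative h (at x) b) (at p) a \<bullet> e"
    by simp
qed

section \<open>Tangent vectors of hypersurfaces\<close>

text \<open>
  Tangent vectors are limits of secant directions. By the intermediate value theorem for
  \<open>s \<mapsto> \<rho> (p + t v + s w)\<close> on \<open>[-e t, e t]\<close> no implicit function theorem is needed.
\<close>

lemma near_tangent_point_pos:
  fixes M :: "'a::euclidean_space set"
  assumes ldf: "local_defining_function M p S \<rho>" and p: "p \<in> M"
    and v: "frechet_derivative \<rho> (at p) v = 0" and w: "frechet_derivative \<rho> (at p) w > 0"
    and e: "e > 0" and d: "d > 0"
  obtains t s where "0 < t" "t < d" "\<bar>s\<bar> \<le> e * t" "p + t *\<^sub>R v + s *\<^sub>R w \<in> M"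
proof -
  from ldf have pS: "p \<in> S" and \<rho>: "smooth_on_open S \<rho>" and MS: "M \<inter> S = {x \<in> S. \<rho> x = 0}"
    by (auto simp: local_defining_function_def)
  have S: "open S" using \<rho> by (simp add: smooth_on_open_def)
  have \<rho>p: "\<rho> p = 0" using MS p pS by auto
  have der: "(\<rho> has_derivative frechet_derivative \<rho> (at p)) (at p)"
    by (rule smooth_on_open_has_derivative[OF \<rho> pS])
  have lin: "linear (frechet_derivative \<rho> (at p))"
    using der by (rule has_derivative_linear)
  have curve: "DERIV (\<lambda>t. \<rho> (p + t *\<^sub>R u)) 0 :> frechet_derivative \<rho> (at p) u" for u
  proof -
    have "((\<lambda>t. \<rho> (p + t *\<^sub>R u)) has_derivative (\<lambda>r. frechet_derivative \<rho> (at p) (r *\<^sub>R u))) (at 0)"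
      by (rule has_derivative_compose[where f = "\<lambda>t. p + t *\<^sub>R u" and g = \<rho>])
        (use der in \<open>auto intro!: derivative_eq_intros\<close>)
    moreover have "(\<lambda>r. frechet_derivative \<rho> (at p) (r *\<^sub>R u)) = (*) (frechet_derivative \<rho> (at p) u)"
      using lin by (auto simp: linear_cmul mult.commute)
    ultimately show ?thesis by (simp add: has_field_derivative_def)
  qed
  \<comment> \<open>As \<open>v\<close> is in the kernel, only the summand with \<open>w\<close>
    counts. For small \<open>t\<close> this gives \<rho> opposite signs at \<open>s = e * t\<close>
    and \<open>s = - (e * t)\<close>, the end points for the intermediate value theorem.\<close>
  have "frechet_derivative \<rho> (at p) (v + e *\<^sub>R w) > 0" "frechet_derivative \<rho> (at p) (v - e *\<^sub>R w) < 0"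
    using v w e lin by (auto simp: linear_add linear_diff linear_cmul)
  from DERIV_pos_inc_right[OF curve this(1)] DERIV_neg_dec_right[OF curve this(2)]
  obtain d1 d2 where d12: "d1 > 0" "d2 > 0"
    and up: "\<And>t. t > 0 \<Longrightarrow> t < d1 \<Longrightarrow> \<rho> (p + t *\<^sub>R (v + e *\<^sub>R w)) > 0"
    and down: "\<And>t. t > 0 \<Longrightarrow> t < d2 \<Longrightarrow> \<rho> (p + t *\<^sub>R (v - e *\<^sub>R w)) < 0"
    using \<rho>p by auto
  obtain r where r: "r > 0" "ball p r \<subseteq> S" using S pS open_contains_ball by blast
  \<comment> \<open>Every point of the segment is within \<open>t * ?c\<close> of \<open>p\<close>,
    so \<open>t < r / ?c\<close> keeps the whole segment inside \<open>S\<close>, where \<rho> is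
    continuous and its zeros are points of \<open>M\<close>.\<close>
  let ?c = "norm v + e * norm w + 1"
  have c: "?c > 0" using e by (smt (verit) mult_nonneg_nonneg norm_ge_zero)
  obtain t where "0 < t" "t < min (min d (r / ?c)) (min d1 d2)"
    using dense[of 0 "min (min d (r / ?c)) (min d1 d2)"] d d12 r c by auto
  then have t: "0 < t" "t < d" "t < d1" "t < d2" "t < r / ?c" by auto
  have inS: "p + t *\<^sub>R v + s *\<^sub>R w \<in> S" if "- (e * t) \<le> s" "s \<le> e * t" for s
  proof -
    have "norm (t *\<^sub>R v + s *\<^sub>R w) \<le> t * norm v + \<bar>s\<bar> * norm w"
      using norm_triangle_ineq[of "t *\<^sub>R v" "s *\<^sub>R w"] t by simp
    also have "\<dots> \<le> t * norm v + (e * t) * norm w"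
      using that by (intro add_mono mult_right_mono) auto
    also have "\<dots> < t * ?c" using t by (simp add: algebra_simps)
    also have "\<dots> < r" using t(5) c by (simp add: pos_less_divide_eq)
    finally have "dist p (p + t *\<^sub>R v + s *\<^sub>R w) < r"
      by (metis add.assoc add_diff_cancel_left' dist_commute dist_norm)
    then show ?thesis using r by auto
  qed
  have cont: "continuous_on {- (e * t)..e * t} (\<lambda>s. \<rho> (p + t *\<^sub>R v + s *\<^sub>R w))"
  proof (rule continuous_on_compose2[of S \<rho>])
    have "C_k_on 0 S \<rho>" using \<rho> unfolding smooth_on_open_def by blast
    then show "continuous_on S \<rho>" by simp
  qed (use inS in \<open>auto intro!: continuous_intros\<close>)
  have "\<exists>s. - (e * t) \<le> s \<and> s \<le> e * t \<and> \<rho> (p + t *\<^sub>R v + s *\<^sub>R w) = 0"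
    using down[OF t(1,4)] up[OF t(1,3)] t e
    by (intro IVT' cont) (auto simp: algebra_simps)
  then obtain s where s: "- (e * t) \<le> s" "s \<le> e * t" "\<rho> (p + t *\<^sub>R v + s *\<^sub>R w) = 0" by blast
  then have "p + t *\<^sub>R v + s *\<^sub>R w \<in> M" using inS[of s] MS by blast
  with s t show thesis by (intro that[of t s]) auto
qed

text \<open>A transversal \<open>w\<close> is replaced by \<open>- w\<close> if the sign of its
  derivative is wrong. The quantifiers over \<open>e\<close> and \<open>d\<close> are inside, so
  that one \<open>w\<close> serves all of them and the error bound built on it has a constant
  independent of \<open>e\<close>.\<close>

lemma near_tangent_point:
  fixes M :: "'a::euclidean_space set"
  assumes ldf: "local_defining_function M p S \<rho>" and p: "p \<in> M"
    and v: "frechet_derivative \<rho> (at p) v = 0"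
  obtains w where "\<And>e d. e > 0 \<Longrightarrow> d > 0 \<Longrightarrow>
    \<exists>t s. 0 < t \<and> t < d \<and> \<bar>s\<bar> \<le> e * t \<and> p + t *\<^sub>R v + s *\<^sub>R w \<in> M"
proof -
  obtain w where w: "frechet_derivative \<rho> (at p) w \<noteq> 0"
    using ldf by (auto simp: local_defining_function_def)
  have "linear (frechet_derivative \<rho> (at p))"
    using ldf by (auto simp: local_defining_function_def
        intro: has_derivative_linear smooth_on_open_has_derivative)
  with w have "frechet_derivative \<rho> (at p) w > 0 \<or> frechet_derivative \<rho> (at p) (- w) > 0"
    by (auto simp: linear_neg)
  then obtain w' where "frechet_derivative \<rho> (at p) w' > 0" by blast
  with near_tangent_point_pos[OF ldf p v] show thesis by (intro that[of w']) metis
qed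

text \<open>The difference \<open>K\<close> of the two maps is a derivative of a function vanishing
  on \<open>M\<close> near \<open>p\<close>. At points
  \<open>p + t *\<^sub>R v + s *\<^sub>R w\<close> of \<open>M\<close> with
  \<open>\<bar>s\<bar> \<le> e * t\<close> this yields \<open>t * norm (K v) \<le> e * t * C\<close>
  with \<open>C\<close> independent of \<open>e\<close>. All later uses of derivatives within
  \<open>M\<close> rest on this uniqueness.\<close>

lemma has_derivative_agree_on_tangent_space:
  fixes M :: "'a::euclidean_space set" and f h :: "'a \<Rightarrow> 'b::real_normed_vector"
  assumes v: "v \<in> tangent_space M p" and p: "p \<in> M"
    and f: "(f has_derivative L) (at p within M)" and h: "(h has_derivative L') (at p within M)"
    and S: "open S" "p \<in> S" and eq: "\<And>x. x \<in> M \<Longrightarrow> x \<in> S \<Longrightarrow> f x = h x"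
  shows "L v = L' v"
proof -
  from v obtain R \<rho> where ldf: "local_defining_function M p R \<rho>"
    and \<rho>v: "frechet_derivative \<rho> (at p) v = 0" by (auto simp: tangent_space_def)
  obtain w where w: "\<And>e d. e > 0 \<Longrightarrow> d > 0 \<Longrightarrow>
      \<exists>t s. 0 < t \<and> t < d \<and> \<bar>s\<bar> \<le> e * t \<and> p + t *\<^sub>R v + s *\<^sub>R w \<in> M"
    using near_tangent_point[OF ldf p \<rho>v] by blast
  obtain r where r: "r > 0" "ball p r \<subseteq> S" using S open_contains_ball by blast
  define K where "K x = L x - L' x" for x
  have K: "((\<lambda>x. f x - h x) has_derivative K) (at p within M)"
    unfolding K_def by (rule has_derivative_diff[OF f h])
  interpret K: linear K using K by (rule has_derivative_linear)
  have "norm (K v) \<le> e * (norm (K w) + norm v + norm w)" if e: "e > 0" "e < 1" for e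
  proof -
    obtain d where d: "d > 0"
      and small: "\<And>y. y \<in> M \<Longrightarrow> norm (y - p) < d \<Longrightarrow>
        norm ((f y - h y) - (f p - h p) - K (y - p)) \<le> e * norm (y - p)"
      using K e unfolding has_derivative_within_alt by blast
    let ?c = "norm v + norm w + 1"
    have c: "?c > 0" by (smt (verit) norm_ge_zero)
    obtain t s where t: "0 < t" "t < min d r / ?c" and s: "\<bar>s\<bar> \<le> e * t"
      and M: "p + t *\<^sub>R v + s *\<^sub>R w \<in> M"
      using w[of e "min d r / ?c"] e d r c by auto
    have s': "\<bar>s\<bar> \<le> t" using s e t by (smt (verit) mult_left_le_one_le)
    let ?y = "p + t *\<^sub>R v + s *\<^sub>R w"
    have y: "?y - p = t *\<^sub>R v + s *\<^sub>R w" by simp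
    have norm_y: "norm (?y - p) \<le> t * (norm v + norm w)"
    proof -
      have "norm (?y - p) \<le> t * norm v + \<bar>s\<bar> * norm w"
        unfolding y using norm_triangle_ineq[of "t *\<^sub>R v" "s *\<^sub>R w"] t by simp
      also have "\<dots> \<le> t * norm v + t * norm w"
        using s' by (intro add_mono mult_right_mono) auto
      finally show ?thesis by (simp add: algebra_simps)
    qed
    also have "\<dots> \<le> t * ?c" using t by (intro mult_left_mono) auto
    also have "\<dots> < min d r" using t c by (simp add: pos_less_divide_eq)
    finally have "norm (?y - p) < d" "norm (?y - p) < r" by auto
    moreover have "dist p ?y = norm (?y - p)" by (metis dist_commute dist_norm)
    ultimately have "norm (?y - p) < d" "dist p ?y < r" by auto
    with r(2) have near: "norm (?y - p) < d" "?y \<in> S" by auto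
    have "norm (K (?y - p)) \<le> e * norm (?y - p)"
      using small[OF M near(1)] eq[OF M near(2)] eq[OF p S(2)] by simp
    also have "\<dots> \<le> e * (t * (norm v + norm w))" using norm_y e by (intro mult_left_mono) auto
    finally have Ky: "norm (K (?y - p)) \<le> e * (t * (norm v + norm w))" .
    have "K (?y - p) = t *\<^sub>R K v + s *\<^sub>R K w" unfolding y by (simp add: K.add K.scale)
    then have "t *\<^sub>R K v = K (?y - p) - s *\<^sub>R K w" by simp
    then have "t * norm (K v) \<le> norm (K (?y - p)) + \<bar>s\<bar> * norm (K w)"
      using norm_triangle_ineq4[of "K (?y - p)" "s *\<^sub>R K w"] t by (metis abs_of_pos norm_scaleR)
    also have "\<dots> \<le> e * (t * (norm v + norm w)) + (e * t) * norm (K w)"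
      using Ky s by (intro add_mono mult_right_mono) auto
    finally have "t * norm (K v) \<le> t * (e * (norm (K w) + norm v + norm w))"
      by (simp add: algebra_simps)
    then show ?thesis using t by simp
  qed
  note le = this
  have "K v = 0"
  proof (rule ccontr)
    define C where "C = norm (K w) + norm v + norm w"
    assume "K v \<noteq> 0"
    then have pos: "norm (K v) > 0" by simp
    have "norm (K v) \<le> (1 / 2) * C" unfolding C_def by (rule le) auto
    with pos have C: "C > 0" by linarith
    \<comment> \<open>This value of \<open>e\<close> is below 1 and makes \<open>e * C\<close> at
      most half of \<open>norm (K v)\<close>, contradicting the bound.\<close>
    have "min (1 / 2) (norm (K v) / (2 * C)) * C \<le> norm (K v) / (2 * C) * C"
      using C by (intro mult_right_mono) auto
    also have "\<dots> = norm (K v) / 2" using C by simp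
    finally have "min (1 / 2) (norm (K v) / (2 * C)) * C \<le> norm (K v) / 2" .
    moreover have "min (1 / 2) (norm (K v) / (2 * C)) < 1"
      by (rule order.strict_trans1[OF min.cobounded1]) simp
    moreover have "min (1 / 2) (norm (K v) / (2 * C)) > 0" using pos C by simp
    ultimately show False
      using le[of "min (1 / 2) (norm (K v) / (2 * C))", folded C_def] pos by linarith
  qed
  then show ?thesis by (simp add: K_def)
qed

text \<open>\<open>frechet_derivative\<close> is a choice operator, hence a genuine derivative as
  soon as one exists; the restriction of the derivative of a local extension is one.\<close>

lemma smooth_along_has_derivative_within:
  assumes "smooth_along M f" "p \<in> M"
  shows "(f has_derivative frechet_derivative f (at p within M)) (at p within M)"
proof -
  obtain S h where S: "p \<in> S" "smooth_on_open S h" and eq: "\<And>x. x \<in> M \<Longrightarrow> x \<in> S \<Longrightarrow> h x = f x"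
    using smooth_alongE[OF assms] by blast
  obtain r where r: "r > 0" "ball p r \<subseteq> S"
    using S open_contains_ball unfolding smooth_on_open_def by blast
  have "(h has_derivative frechet_derivative h (at p)) (at p within M)"
    using smooth_on_open_has_derivative[OF S(2,1)] by (rule has_derivative_at_withinI)
  then have "(f has_derivative frechet_derivative h (at p)) (at p within M)"
    by (rule has_derivative_transform_within[OF _ r(1) assms(2)])
      (use r eq in \<open>auto simp: dist_commute subset_iff\<close>)
  then show ?thesis by (meson differentiableI frechet_derivative_works)
qed

text \<open>A tangent vector may be witnessed by a different defining function. But \<rho> agrees
  with 0 on \<open>M\<close> near \<open>p\<close>, so its derivative agrees with 0 on every tangent
  vector, whatever the witness.\<close>

lemma tangent_space_eq_kernel:
  fixes M :: "'a::euclidean_space set"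
  assumes ldf: "local_defining_function M p S \<rho>" and p: "p \<in> M"
  shows "tangent_space M p = {v. frechet_derivative \<rho> (at p) v = 0}"
proof
  show "{v. frechet_derivative \<rho> (at p) v = 0} \<subseteq> tangent_space M p"
    using ldf by (auto simp: tangent_space_def)
  show "tangent_space M p \<subseteq> {v. frechet_derivative \<rho> (at p) v = 0}"
  proof
    fix v assume v: "v \<in> tangent_space M p"
    have S: "p \<in> S" "smooth_on_open S \<rho>" "M \<inter> S = {x \<in> S. \<rho> x = 0}"
      using ldf by (auto simp: local_defining_function_def)
    have "frechet_derivative \<rho> (at p) v = (\<lambda>_. 0) v"
    proof (rule has_derivative_agree_on_tangent_space[OF v p])
      show "(\<rho> has_derivative frechet_derivative \<rho> (at p)) (at p within M)"
        using smooth_on_open_has_derivative[OF S(2,1)] by (rule has_derivative_at_withinI)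
      show "((\<lambda>_. 0) has_derivative (\<lambda>_. 0)) (at p within M)" by simp
      show "open S" using S by (simp add: smooth_on_open_def)
    qed (use S in auto)
    then show "v \<in> {v. frechet_derivative \<rho> (at p) v = 0}" by simp
  qed
qed

locale oriented_hypersurface =
  fixes M :: "'a::euclidean_space set" and \<nu> :: "'a \<Rightarrow> 'a"
  assumes hypersurface: "smooth_hypersurface M" and normal: "unit_normal_field M \<nu>"
begin

lemma smooth_normal: "smooth_along M \<nu>"
  and inner_normal: "p \<in> M \<Longrightarrow> \<nu> p \<bullet> \<nu> p = 1"
  using normal by (auto simp: unit_normal_field_def dot_square_norm)

text \<open>By hypothesis the kernel of the differential of \<rho> lies in the hyperplane orthogonal
  to \<nu>. Moving \<open>v\<close> along a transversal \<open>w\<close> into that kernel shows that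
  the two functionals are proportional, and the factor is nonzero because \<nu> is a unit
  vector.\<close>

lemma tangent_space_eq:
  assumes p: "p \<in> M"
  shows "tangent_space M p = {v. \<nu> p \<bullet> v = 0}"
proof -
  obtain S \<rho> where ldf: "local_defining_function M p S \<rho>"
    using hypersurface p by (auto simp: smooth_hypersurface_def)
  let ?L = "frechet_derivative \<rho> (at p)"
  have ker: "tangent_space M p = {v. ?L v = 0}" by (rule tangent_space_eq_kernel[OF ldf p])
  have "bounded_linear ?L"
    using ldf by (auto simp: local_defining_function_def
        intro: has_derivative_bounded_linear smooth_on_open_has_derivative)
  then interpret L: bounded_linear ?L .
  obtain w where w: "?L w \<noteq> 0" using ldf by (auto simp: local_defining_function_def)
  have orth: "\<nu> p \<bullet> v = 0" if "?L v = 0" for v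
    using normal p ker that by (auto simp: unit_normal_field_def)
  have eq: "\<nu> p \<bullet> v = (?L v / ?L w) * (\<nu> p \<bullet> w)" for v
  proof -
    have "?L (v - (?L v / ?L w) *\<^sub>R w) = 0" using w by (simp add: L.diff L.scaleR)
    from orth[OF this] show ?thesis by (simp add: inner_diff_right)
  qed
  have "\<nu> p \<bullet> w \<noteq> 0" using eq[of "\<nu> p"] inner_normal[OF p] by auto
  then have "?L v = 0 \<longleftrightarrow> \<nu> p \<bullet> v = 0" for v using eq[of v] w by auto
  with ker show ?thesis by auto
qed

end

section \<open>Algebra of complexified vectors\<close>

lemma fst_cvec_scale [simp]: "fst (c *\<^sub>c v) = Re c *\<^sub>R fst v - Im c *\<^sub>R snd v"
  and snd_cvec_scale [simp]: "snd (c *\<^sub>c v) = Re c *\<^sub>R snd v + Im c *\<^sub>R fst v"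
  by (simp_all add: cvec_scale_def)

lemma fst_cvec_cnj [simp]: "fst (cvec_cnj v) = fst v"
  and snd_cvec_cnj [simp]: "snd (cvec_cnj v) = - snd v"
  by (simp_all add: cvec_cnj_def)

lemma fst_J [simp]: "fst (J v) = J_real (fst v)"
  and snd_J [simp]: "snd (J v) = J_real (snd v)"
  by (simp_all add: J_def)

interpretation cvec: vector_space "cvec_scale :: complex \<Rightarrow> 'm::finite cvec \<Rightarrow> 'm cvec"
  by unfold_locales (auto simp: prod_eq_iff algebra_simps)

lemma bounded_linear_J_real: "bounded_linear J_real"
  unfolding linear_conv_bounded_linear[symmetric] by (rule linearI) (auto simp: J_real_def vec_eq_iff algebra_simps)

lemmas linear_J_real = bounded_linear.linear[OF bounded_linear_J_real]
lemmas J_real_add = linear_add[OF linear_J_real]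
  and J_real_diff = linear_diff[OF linear_J_real]
  and J_real_scaleR = linear_cmul[OF linear_J_real]
  and J_real_minus = linear_neg[OF linear_J_real]

lemma J_real_J_real [simp]: "J_real (J_real x) = - x"
  by (simp add: J_real_def vec_eq_iff)

lemma inner_J_real_J_real [simp]: "J_real x \<bullet> J_real y = x \<bullet> y"
  by (simp add: J_real_def inner_vec_def inner_complex_def algebra_simps)

lemma inner_J_real_left: "J_real x \<bullet> y = - (x \<bullet> J_real y)"
  using inner_J_real_J_real[of "J_real x" y] by simp

lemma inner_J_real_self [simp]: "x \<bullet> J_real x = 0"
  using inner_J_real_left[of x x] by (simp add: inner_commute)

lemma bounded_bilinear_cvec_scale: "bounded_bilinear cvec_scale"
  unfolding bilinear_conv_bounded_bilinear[symmetric] bilinear_def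
  by (auto intro!: linearI simp: prod_eq_iff algebra_simps)

lemma bounded_bilinear_g: "bounded_bilinear g"
  unfolding bilinear_conv_bounded_bilinear[symmetric] bilinear_def
  by (auto intro!: linearI simp: g_def complex_eq_iff algebra_simps inner_simps)

lemma bounded_linear_J: "bounded_linear J"
  unfolding linear_conv_bounded_linear[symmetric]
  by (auto intro!: linearI simp: prod_eq_iff J_real_add J_real_scaleR)

lemma bounded_linear_cvec_cnj: "bounded_linear cvec_cnj"
  unfolding linear_conv_bounded_linear[symmetric]
  by (auto intro!: linearI simp: prod_eq_iff)

interpretation g: bounded_bilinear "g :: 'm::finite cvec \<Rightarrow> 'm cvec \<Rightarrow> complex"
  by (rule bounded_bilinear_g)

lemmas linear_J = bounded_linear.linear[OF bounded_linear_J]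
lemmas J_add = linear_add[OF linear_J]
  and J_diff = linear_diff[OF linear_J]

lemmas linear_cvec_cnj = bounded_linear.linear[OF bounded_linear_cvec_cnj]
lemmas cvec_cnj_add = linear_add[OF linear_cvec_cnj]
  and cvec_cnj_diff = linear_diff[OF linear_cvec_cnj]
  and cvec_cnj_minus = linear_neg[OF linear_cvec_cnj]

lemma g_scale_left: "g (c *\<^sub>c v) w = c * g v w"
  and g_scale_right: "g v (c *\<^sub>c w) = c * g v w"
  by (simp_all add: g_def complex_eq_iff algebra_simps inner_simps)

lemma g_commute: "g v w = g w v"
  by (simp add: g_def complex_eq_iff inner_commute)

lemma g_J_J: "g (J v) (J w) = g v w"
  by (simp add: g_def)

lemma g_J_left: "g (J v) w = - g v (J w)"
  by (simp add: g_def complex_eq_iff inner_J_real_left)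

lemma g_cnj_cnj: "g (cvec_cnj v) (cvec_cnj w) = cnj (g v w)"
  by (simp add: g_def complex_eq_iff)

lemma J_scale: "J (c *\<^sub>c v) = c *\<^sub>c J v"
  by (simp add: prod_eq_iff J_real_add J_real_diff J_real_scaleR)

lemma J_J [simp]: "J (J v) = - v"
  by (simp add: prod_eq_iff)

lemma J_cnj: "J (cvec_cnj v) = cvec_cnj (J v)"
  by (simp add: prod_eq_iff J_real_minus)

lemma cvec_cnj_cnj [simp]: "cvec_cnj (cvec_cnj v) = v"
  by (simp add: prod_eq_iff)

lemma cvec_cnj_scale: "cvec_cnj (c *\<^sub>c v) = cnj c *\<^sub>c cvec_cnj v"
  by (simp add: prod_eq_iff)

lemmas g_simps = g.add_left g.add_right g.diff_left g.diff_right g.minus_left g.minus_right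
  g_scale_left g_scale_right

lemma type10_iff: "v \<in> type10 \<longleftrightarrow> J v = \<i> *\<^sub>c v"
  by (simp add: type10_def)

section \<open>Types (1,0) and (0,1), and the holomorphic normal\<close>

lemma type01_iff: "cvec_cnj v \<in> type10 \<longleftrightarrow> J v = - (\<i> *\<^sub>c v)"
proof -
  have "J (cvec_cnj v) = \<i> *\<^sub>c cvec_cnj v \<longleftrightarrow> cvec_cnj (J (cvec_cnj v)) = cvec_cnj (\<i> *\<^sub>c cvec_cnj v)"
    by (metis cvec_cnj_cnj)
  then show ?thesis by (simp add: type10_iff J_cnj cvec_cnj_scale)
qed

text \<open>\<open>J\<close> is an isometry for the bilinear \<open>g\<close>, and on this type it
  is multiplication by i, so \<open>g v w\<close> equals i * i times itself.\<close>

lemma g_type10_type10: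
  assumes "v \<in> type10" "w \<in> type10"
  shows "g v w = 0"
  using g_J_J[of v w] assms by (simp add: type10_iff g_simps)

lemma g_type01_type01:
  assumes "cvec_cnj v \<in> type10" "cvec_cnj w \<in> type10"
  shows "g v w = 0"
  using g_type10_type10[OF assms] g_cnj_cnj[of v w] by simp

lemma g_cvec_of_real: "g v (cvec_of_real x) = Complex (fst v \<bullet> x) (snd v \<bullet> x)"
  by (simp add: g_def cvec_of_real_def)

lemma cvec_cnj_of_real [simp]: "cvec_cnj (cvec_of_real x) = cvec_of_real x"
  by (simp add: cvec_cnj_def cvec_of_real_def)

lemma cvec_cnj_T_field [simp]: "cvec_cnj (T_field \<nu> p) = T_field \<nu> p"
  by (simp add: T_field_def flip: J_cnj)

lemma g_normal_T_field: "g (cvec_of_real (\<nu> p)) (T_field \<nu> p) = 0"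
  by (simp add: T_field_def g_def cvec_of_real_def complex_eq_iff linear_0[OF linear_J_real])

lemma J_T_field: "J (T_field \<nu> p) = - cvec_of_real (\<nu> p)"
  by (simp add: T_field_def)

text \<open>\<open>J\<close> sends \<nu> to T and T to -\<nu>, hence \<nu> - i T to T + i \<nu> = i
  (\<nu> - i T).\<close>

lemma N_field_type10: "N_field \<nu> p \<in> type10"
  unfolding type10_iff N_field_def J_scale J_diff J_T_field
  by (simp add: T_field_def[symmetric] cvec.scale_right_diff_distrib algebra_simps)

lemma cvec_cnj_N_field:
  "cvec_cnj (N_field \<nu> p) = complex_of_real (1 / sqrt 2) *\<^sub>c (cvec_of_real (\<nu> p) + \<i> *\<^sub>c T_field \<nu> p)"
  by (simp add: N_field_def cvec_cnj_scale cvec_cnj_diff)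

lemma inv_sqrt2_squared:
  "complex_of_real (1 / sqrt 2) * (complex_of_real (1 / sqrt 2) * c) = c / 2"
  by (simp add: mult.assoc[symmetric] of_real_mult[symmetric] del: of_real_mult)

text \<open>Serves to trade orthogonality to \<nu> for orthogonality to N and its conjugate, one of
  which is automatic for a vector of pure type.\<close>

lemma normal_eq_N_field:
  "cvec_of_real (\<nu> p) = complex_of_real (1 / sqrt 2) *\<^sub>c (N_field \<nu> p + cvec_cnj (N_field \<nu> p))"
proof -
  have "N_field \<nu> p + cvec_cnj (N_field \<nu> p) =
      complex_of_real (1 / sqrt 2) *\<^sub>c (2 *\<^sub>c cvec_of_real (\<nu> p))"
  proof -
    have "v - w + (v + w) = 2 *\<^sub>c v" for v w :: "'a cvec"
      by (simp add: prod_eq_iff scaleR_2)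
    then show ?thesis
      unfolding cvec_cnj_N_field unfolding N_field_def cvec.scale_right_distrib[symmetric]
      by (simp only:)
  qed
  then show ?thesis using inv_sqrt2_squared[of 2] by (simp add: mult.assoc del: of_real_divide)
qed

text \<open>The coefficient of N is a product with the conjugate of N because \<open>g\<close> is
  bilinear: it is the Hermitian product of \<open>w\<close> with N. On vectors of type (1,0) this is
  the orthogonal projection onto the holomorphic tangent space.\<close>

definition hol_proj :: "(complex ^ 'm::finite \<Rightarrow> complex ^ 'm) \<Rightarrow> complex ^ 'm \<Rightarrow> 'm cvec \<Rightarrow> 'm cvec" where
  "hol_proj \<nu> p w = w - g w (cvec_cnj (N_field \<nu> p)) *\<^sub>c N_field \<nu> p"

definition antihol_proj :: "(complex ^ 'm::finite \<Rightarrow> complex ^ 'm) \<Rightarrow> complex ^ 'm \<Rightarrow> 'm cvec \<Rightarrow> 'm cvec" where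
  "antihol_proj \<nu> p w = w - g w (N_field \<nu> p) *\<^sub>c cvec_cnj (N_field \<nu> p)"

lemma hol_proj_0 [simp]: "hol_proj \<nu> p 0 = 0"
  and antihol_proj_0 [simp]: "antihol_proj \<nu> p 0 = 0"
  by (simp_all add: hol_proj_def antihol_proj_def g.zero_left)

lemma hol_proj_add: "hol_proj \<nu> p (v + w) = hol_proj \<nu> p v + hol_proj \<nu> p w"
  and antihol_proj_add: "antihol_proj \<nu> p (v + w) = antihol_proj \<nu> p v + antihol_proj \<nu> p w"
  by (simp_all add: hol_proj_def antihol_proj_def g_simps cvec.scale_left_distrib)

lemma hol_proj_scale: "hol_proj \<nu> p (c *\<^sub>c v) = c *\<^sub>c hol_proj \<nu> p v"
  and antihol_proj_scale: "antihol_proj \<nu> p (c *\<^sub>c v) = c *\<^sub>c antihol_proj \<nu> p v"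
  by (simp_all add: hol_proj_def antihol_proj_def g_simps cvec.scale_right_diff_distrib)

lemma cvec_cnj_hol_proj: "cvec_cnj (hol_proj \<nu> p v) = antihol_proj \<nu> p (cvec_cnj v)"
  using g_cnj_cnj[of v "cvec_cnj (N_field \<nu> p)"]
  by (simp add: hol_proj_def antihol_proj_def cvec_cnj_diff cvec_cnj_scale)

lemma cvec_cnj_antihol_proj: "cvec_cnj (antihol_proj \<nu> p v) = hol_proj \<nu> p (cvec_cnj v)"
  by (metis cvec_cnj_cnj cvec_cnj_hol_proj)

lemma hol_proj_type10: "v \<in> type10 \<Longrightarrow> hol_proj \<nu> p v \<in> type10"
  using N_field_type10[of \<nu> p]
  by (simp add: type10_iff hol_proj_def J_diff J_scale cvec.scale_right_diff_distrib mult.commute)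

text \<open>The product with N vanishes by type. The product with conj N vanishes because g(N, conj
  N) is half of g(\<nu>, \<nu>) + g(T, T), that is 1. The normal is a combination of the
  two.\<close>

lemma hol_proj_orthogonal_normal:
  assumes unit: "\<nu> p \<bullet> \<nu> p = 1" and v: "v \<in> type10"
  shows "g (hol_proj \<nu> p v) (cvec_of_real (\<nu> p)) = 0"
proof -
  have "g (N_field \<nu> p) (cvec_cnj (N_field \<nu> p)) = 1"
  proof -
    have "g (cvec_of_real (\<nu> p)) (cvec_of_real (\<nu> p)) = 1" "g (T_field \<nu> p) (T_field \<nu> p) = 1"
      using unit by (simp_all add: T_field_def g_J_J g_def cvec_of_real_def complex_eq_iff)
    then show ?thesis
      unfolding cvec_cnj_N_field unfolding N_field_def g_simps g_commute[of "T_field \<nu> p" "cvec_of_real (\<nu> p)"]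
      using inv_sqrt2_squared[of 2]
      by (simp add: g_normal_T_field algebra_simps del: of_real_divide)
  qed
  then show ?thesis
    using g_type10_type10[OF v N_field_type10, of \<nu> p]
      g_type10_type10[OF N_field_type10 N_field_type10, of \<nu> p \<nu> p]
    by (simp add: normal_eq_N_field hol_proj_def g_simps)
qed

text \<open>This and the next two definitions give the splitting by explicit formulas, from which
  smoothness of the components can be read off, unlike from the definite description
  \<open>split_at\<close>.\<close>

definition levi_part :: "(complex ^ 'm::finite \<Rightarrow> complex ^ 'm) \<Rightarrow> complex ^ 'm \<Rightarrow> 'm cvec \<Rightarrow> 'm cvec" where
  "levi_part \<nu> p v = v - g v (T_field \<nu> p) *\<^sub>c T_field \<nu> p"

text \<open>(1 - i J) / 2 is the projection onto the eigenspace of \<open>J\<close> for i;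
  \<open>antihol_part\<close> uses the one for -i.\<close>

definition hol_part :: "(complex ^ 'm::finite \<Rightarrow> complex ^ 'm) \<Rightarrow> complex ^ 'm \<Rightarrow> 'm cvec \<Rightarrow> 'm cvec" where
  "hol_part \<nu> p v = (1 / 2) *\<^sub>c (levi_part \<nu> p v - \<i> *\<^sub>c J (levi_part \<nu> p v))"

definition antihol_part :: "(complex ^ 'm::finite \<Rightarrow> complex ^ 'm) \<Rightarrow> complex ^ 'm \<Rightarrow> 'm cvec \<Rightarrow> 'm cvec" where
  "antihol_part \<nu> p v = (1 / 2) *\<^sub>c (levi_part \<nu> p v + \<i> *\<^sub>c J (levi_part \<nu> p v))"

lemma parts_sum: "hol_part \<nu> p v + antihol_part \<nu> p v + g v (T_field \<nu> p) *\<^sub>c T_field \<nu> p = v"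
proof -
  have "hol_part \<nu> p v + antihol_part \<nu> p v = levi_part \<nu> p v"
    unfolding hol_part_def antihol_part_def cvec.scale_right_distrib[symmetric]
    by (simp add: prod_eq_iff flip: scaleR_2)
  then show ?thesis by (simp add: levi_part_def)
qed

lemma hol_part_type10: "hol_part \<nu> p v \<in> type10"
  by (simp add: type10_iff hol_part_def J_scale J_diff cvec.scale_right_diff_distrib
      algebra_simps)

lemma antihol_part_type01: "cvec_cnj (antihol_part \<nu> p v) \<in> type10"
  by (simp add: type01_iff antihol_part_def J_scale J_add cvec.scale_right_distrib
      algebra_simps)

section \<open>Derivatives along complexified tangent vectors\<close>

locale oriented_complex_hypersurface = oriented_hypersurface M \<nu>
  for M :: "(complex ^ 'm::finite) set" and \<nu> :: "complex ^ 'm \<Rightarrow> complex ^ 'm"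
begin

text \<open>Real and imaginary part of one complex equation are the tangency conditions for the two
  components. Tangency becomes linear algebra with \<open>g\<close>.\<close>

lemma ctangent_space_iff:
  "p \<in> M \<Longrightarrow> v \<in> ctangent_space M p \<longleftrightarrow> g v (cvec_of_real (\<nu> p)) = 0"
  by (auto simp: ctangent_space_def tangent_space_eq g_cvec_of_real inner_commute complex_eq_iff
      mem_Times_iff)

lemma hol_tangent_iff:
  "p \<in> M \<Longrightarrow> v \<in> hol_tangent M p \<longleftrightarrow> v \<in> type10 \<and> g v (cvec_of_real (\<nu> p)) = 0"
  by (auto simp: hol_tangent_def ctangent_space_iff)

lemma antihol_tangent_iff:
  "v \<in> antihol_tangent M p \<longleftrightarrow> cvec_cnj v \<in> hol_tangent M p"
  by (auto simp: antihol_tangent_def intro!: image_eqI[where x = "cvec_cnj v"])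

lemma ctangent_space_cnj:
  "p \<in> M \<Longrightarrow> cvec_cnj v \<in> ctangent_space M p \<longleftrightarrow> v \<in> ctangent_space M p"
  using g_cnj_cnj[of v "cvec_of_real (\<nu> p)"] by (simp add: ctangent_space_iff)

lemma ctangent_space_add:
  "p \<in> M \<Longrightarrow> v \<in> ctangent_space M p \<Longrightarrow> w \<in> ctangent_space M p \<Longrightarrow> v + w \<in> ctangent_space M p"
  by (simp add: ctangent_space_iff g_simps)

lemma ctangent_space_scale:
  "p \<in> M \<Longrightarrow> v \<in> ctangent_space M p \<Longrightarrow> c *\<^sub>c v \<in> ctangent_space M p"
  by (simp add: ctangent_space_iff g_simps)

lemma hol_tangent_ctangent: "v \<in> hol_tangent M p \<Longrightarrow> v \<in> ctangent_space M p"
  by (simp add: hol_tangent_def)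

lemma antihol_tangent_ctangent:
  "p \<in> M \<Longrightarrow> v \<in> antihol_tangent M p \<Longrightarrow> v \<in> ctangent_space M p"
  using antihol_tangent_iff ctangent_space_cnj hol_tangent_ctangent by blast

lemma T_field_ctangent: "p \<in> M \<Longrightarrow> T_field \<nu> p \<in> ctangent_space M p"
  by (simp add: ctangent_space_iff g_commute[of "T_field \<nu> p"] g_normal_T_field)

lemma g_T_T: "p \<in> M \<Longrightarrow> g (T_field \<nu> p) (T_field \<nu> p) = 1"
  by (simp add: T_field_def g_J_J g_def cvec_of_real_def complex_eq_iff inner_normal)

text \<open>With T = J \<nu> and \<open>J\<close> skew, g(z, T) = - g(J z, \<nu>) = - i g(z, \<nu>)
  = 0.\<close>

lemma g_hol_T:
  assumes "p \<in> M" "z \<in> hol_tangent M p"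
  shows "g z (T_field \<nu> p) = 0"
  using assms g_J_left[of z "cvec_of_real (\<nu> p)"]
  by (simp add: hol_tangent_iff type10_iff T_field_def g_simps)

lemma g_antihol_T:
  assumes "p \<in> M" "w \<in> antihol_tangent M p"
  shows "g w (T_field \<nu> p) = 0"
  using g_hol_T[OF assms(1), of "cvec_cnj w"] assms antihol_tangent_iff g_cnj_cnj[of w "T_field \<nu> p"]
  by simp

text \<open>The T component must be removed before \<open>J\<close> is applied: g(J x, \<nu>) = -
  g(x, T), so \<open>J\<close> keeps a vector tangent exactly when it has no T component.\<close>

lemma hol_part_tangent:
  assumes p: "p \<in> M" and v: "v \<in> ctangent_space M p"
  shows "hol_part \<nu> p v \<in> hol_tangent M p" "antihol_part \<nu> p v \<in> antihol_tangent M p"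
proof -
  have 1: "g (levi_part \<nu> p v) (cvec_of_real (\<nu> p)) = 0"
    using v p by (simp add: levi_part_def g_simps ctangent_space_iff g_normal_T_field
        g_commute[of "T_field \<nu> p"])
  have "g (levi_part \<nu> p v) (T_field \<nu> p) = 0"
    using p by (simp add: levi_part_def g_simps g_T_T)
  then have 2: "g (J (levi_part \<nu> p v)) (cvec_of_real (\<nu> p)) = 0"
    by (simp add: g_J_left T_field_def)
  show "hol_part \<nu> p v \<in> hol_tangent M p"
    using 1 2 p by (simp add: hol_tangent_iff hol_part_type10) (simp add: hol_part_def g_simps)
  have "g (antihol_part \<nu> p v) (cvec_of_real (\<nu> p)) = 0"
    using 1 2 by (simp add: antihol_part_def g_simps)
  then show "antihol_part \<nu> p v \<in> antihol_tangent M p"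
    using p antihol_part_type01 g_cnj_cnj[of "antihol_part \<nu> p v" "cvec_of_real (\<nu> p)"]
    by (simp add: antihol_tangent_iff hol_tangent_iff)
qed

text \<open>Pairing with T isolates \<open>c\<close>, since the other two summands are orthogonal to
  T; the different eigenvalues of \<open>J\<close> then separate \<open>z\<close> from
  \<open>w\<close>.\<close>

lemma split_unique:
  assumes p: "p \<in> M" and z: "z \<in> hol_tangent M p" and w: "w \<in> antihol_tangent M p"
    and v: "v = z + w + c *\<^sub>c T_field \<nu> p"
  shows "z = hol_part \<nu> p v" "w = antihol_part \<nu> p v" "c = g v (T_field \<nu> p)"
proof -
  show c: "c = g v (T_field \<nu> p)"
    using g_hol_T[OF p z] g_antihol_T[OF p w] g_T_T[OF p] by (simp add: v g_simps)
  have lev: "levi_part \<nu> p v = z + w"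
    using v unfolding levi_part_def c[symmetric] by simp
  have J: "J z = \<i> *\<^sub>c z" "J w = - (\<i> *\<^sub>c w)"
    using p z w type01_iff[of w] by (simp_all add: hol_tangent_iff antihol_tangent_iff type10_iff)
  have half: "x = (1 / 2) *\<^sub>c (x + x)" for x :: "'m cvec"
    by (simp add: prod_eq_iff flip: scaleR_2)
  show "z = hol_part \<nu> p v"
    using half[of z] by (simp add: hol_part_def lev J_add J algebra_simps)
  show "w = antihol_part \<nu> p v"
    using half[of w] by (simp add: antihol_part_def lev J_add J algebra_simps)
qed

lemma split_at_eq:
  assumes p: "p \<in> M" and v: "v \<in> ctangent_space M p"
  shows "split_at M \<nu> p v = (hol_part \<nu> p v, cvec_cnj (antihol_part \<nu> p v), g v (T_field \<nu> p))"
  unfolding split_at_def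
proof (rule the_equality)
  show "case (hol_part \<nu> p v, cvec_cnj (antihol_part \<nu> p v), g v (T_field \<nu> p)) of (z, w, c) \<Rightarrow>
      z \<in> hol_tangent M p \<and> w \<in> hol_tangent M p \<and> v = z + cvec_cnj w + c *\<^sub>c T_field \<nu> p"
    using hol_part_tangent[OF p v] parts_sum[of \<nu> p v] p by (simp add: antihol_tangent_iff)
next
  fix x
  assume "case x of (z, w, c) \<Rightarrow>
      z \<in> hol_tangent M p \<and> w \<in> hol_tangent M p \<and> v = z + cvec_cnj w + c *\<^sub>c T_field \<nu> p"
  then obtain z w c where x: "x = (z, w, c)" and zw: "z \<in> hol_tangent M p" "w \<in> hol_tangent M p"
    and eq: "v = z + cvec_cnj w + c *\<^sub>c T_field \<nu> p" by auto
  have "cvec_cnj w \<in> antihol_tangent M p" using zw p by (simp add: antihol_tangent_iff)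
  from split_unique[OF p zw(1) this eq] x
  show "x = (hol_part \<nu> p v, cvec_cnj (antihol_part \<nu> p v), g v (T_field \<nu> p))"
    by (metis cvec_cnj_cnj)
qed

text \<open>The source of all differentiation rules below: compute any derivative \<open>L\<close>
  of any function with the same values on \<open>M\<close>, then evaluate it on tangent vectors,
  where the chosen derivative must agree.\<close>

lemma has_derivative_within_tangent_eq:
  assumes "p \<in> M" "v \<in> tangent_space M p" "smooth_along M f"
    and "(f' has_derivative L) (at p within M)" "\<And>q. q \<in> M \<Longrightarrow> f q = f' q"
  shows "frechet_derivative f (at p within M) v = L v"
  by (rule has_derivative_agree_on_tangent_space[OF assms(2,1)
        smooth_along_has_derivative_within[OF assms(3,1)] assms(4) open_UNIV])
    (use assms(5) in auto)

lemma D_at_eq: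
  assumes "p \<in> M" "u \<in> ctangent_space M p" "smooth_along M V"
    and "(V' has_derivative L) (at p within M)" "\<And>q. q \<in> M \<Longrightarrow> V q = V' q"
  shows "D_at M u V p = L (fst u) + \<i> *\<^sub>c L (snd u)"
  using assms(2) has_derivative_within_tangent_eq[OF assms(1) _ assms(3-5)]
  by (auto simp: D_at_def ctangent_space_def)

lemma fun_deriv_eq:
  assumes "p \<in> M" "u \<in> ctangent_space M p" "smooth_along M f"
    and "(f' has_derivative L) (at p within M)" "\<And>q. q \<in> M \<Longrightarrow> f q = f' q"
  shows "fun_deriv M u f p = L (fst u) + \<i> * L (snd u)"
  using assms(2) has_derivative_within_tangent_eq[OF assms(1) _ assms(3-5)]
  by (auto simp: fun_deriv_def ctangent_space_def)

text \<open>Components produced by \<open>split_at\<close> are known on \<open>M\<close> only, so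
  they can be replaced by smooth representatives only through such a rule.\<close>

lemma D_at_cong:
  assumes "p \<in> M" "u \<in> ctangent_space M p" "smooth_along M V" "\<And>q. q \<in> M \<Longrightarrow> V q = V' q"
  shows "D_at M u V p = D_at M u V' p"
  using D_at_eq[OF assms(1-3) smooth_along_has_derivative_within[of M V' p] assms(4)]
    smooth_along_cong[OF assms(3,4)] assms(1) by (simp add: D_at_def)

lemma fun_deriv_cong:
  assumes "p \<in> M" "u \<in> ctangent_space M p" "smooth_along M f" "\<And>q. q \<in> M \<Longrightarrow> f q = f' q"
  shows "fun_deriv M u f p = fun_deriv M u f' p"
  using fun_deriv_eq[OF assms(1-3) smooth_along_has_derivative_within[of M f' p] assms(4)]
    smooth_along_cong[OF assms(3,4)] assms(1) by (simp add: fun_deriv_def)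

section \<open>Calculus of the flat derivative\<close>

lemma D_at_bounded_linear:
  assumes p: "p \<in> M" and u: "u \<in> ctangent_space M p" and V: "smooth_along M V"
    and L: "bounded_linear L" "\<And>c v. L (c *\<^sub>c v) = c *\<^sub>c L v"
  shows "D_at M u (\<lambda>q. L (V q)) p = L (D_at M u V p)"
  using D_at_eq[OF p u smooth_along_bounded_linear[OF L(1) V]
      bounded_linear.has_derivative[OF L(1) smooth_along_has_derivative_within[OF V p]] refl]
  by (simp add: D_at_def L(2) linear_add[OF bounded_linear.linear[OF L(1)]])

lemma D_at_J:
  assumes "p \<in> M" "u \<in> ctangent_space M p" "smooth_along M V"
  shows "D_at M u (\<lambda>q. J (V q)) p = J (D_at M u V p)"
  by (rule D_at_bounded_linear[OF assms bounded_linear_J J_scale])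

lemma D_at_const_scale:
  assumes "p \<in> M" "u \<in> ctangent_space M p" "smooth_along M V"
  shows "D_at M u (\<lambda>q. c *\<^sub>c V q) p = c *\<^sub>c D_at M u V p"
  by (rule D_at_bounded_linear[OF assms])
    (auto simp: mult.commute intro: bounded_bilinear.bounded_linear_right bounded_bilinear_cvec_scale)

lemma D_at_cnj:
  assumes p: "p \<in> M" and u: "u \<in> ctangent_space M p" and V: "smooth_along M V"
  shows "D_at M (cvec_cnj u) (\<lambda>q. cvec_cnj (V q)) p = cvec_cnj (D_at M u V p)"
proof -
  have lin: "linear (frechet_derivative V (at p within M))"
    using has_derivative_linear[OF smooth_along_has_derivative_within[OF V p]] .
  have u': "cvec_cnj u \<in> ctangent_space M p" using u p by (simp add: ctangent_space_cnj)
  show ?thesis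
    using D_at_eq[OF p u' smooth_along_bounded_linear[OF bounded_linear_cvec_cnj V]
        bounded_linear.has_derivative[OF bounded_linear_cvec_cnj
          smooth_along_has_derivative_within[OF V p]] refl]
    by (simp add: D_at_def cvec_cnj_add cvec_cnj_scale linear_neg[OF lin] cvec_cnj_minus)
qed

lemma fun_deriv_cnj:
  assumes p: "p \<in> M" and u: "u \<in> ctangent_space M p" and f: "smooth_along M f"
  shows "fun_deriv M (cvec_cnj u) (\<lambda>q. cnj (f q)) p = cnj (fun_deriv M u f p)"
proof -
  have lin: "linear (frechet_derivative f (at p within M))"
    using has_derivative_linear[OF smooth_along_has_derivative_within[OF f p]] .
  have u': "cvec_cnj u \<in> ctangent_space M p" using u p by (simp add: ctangent_space_cnj)
  show ?thesis
    using fun_deriv_eq[OF p u' smooth_along_bounded_linear[OF bounded_linear_cnj f]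
        bounded_linear.has_derivative[OF bounded_linear_cnj
          smooth_along_has_derivative_within[OF f p]] refl]
    by (simp add: fun_deriv_def linear_neg[OF lin])
qed

lemma D_at_add:
  assumes p: "p \<in> M" and u: "u \<in> ctangent_space M p"
    and V: "smooth_along M V" and W: "smooth_along M W"
  shows "D_at M u (\<lambda>q. V q + W q) p = D_at M u V p + D_at M u W p"
  using D_at_eq[OF p u smooth_along_add[OF V W] has_derivative_add[OF
        smooth_along_has_derivative_within[OF V p] smooth_along_has_derivative_within[OF W p]] refl]
  by (simp add: D_at_def cvec.scale_right_distrib)

lemma fun_deriv_add:
  assumes p: "p \<in> M" and u: "u \<in> ctangent_space M p"
    and V: "smooth_along M V" and W: "smooth_along M W"
  shows "fun_deriv M u (\<lambda>q. V q + W q) p = fun_deriv M u V p + fun_deriv M u W p"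
  using fun_deriv_eq[OF p u smooth_along_add[OF V W] has_derivative_add[OF
        smooth_along_has_derivative_within[OF V p] smooth_along_has_derivative_within[OF W p]] refl]
  by (simp add: fun_deriv_def algebra_simps)

lemma D_at_scale:
  assumes p: "p \<in> M" and u: "u \<in> ctangent_space M p"
    and f: "smooth_along M f" and V: "smooth_along M V"
  shows "D_at M u (\<lambda>q. f q *\<^sub>c V q) p = f p *\<^sub>c D_at M u V p + fun_deriv M u f p *\<^sub>c V p"
  using D_at_eq[OF p u smooth_along_bounded_bilinear[OF bounded_bilinear_cvec_scale f V]
      bounded_bilinear.FDERIV[OF bounded_bilinear_cvec_scale
        smooth_along_has_derivative_within[OF f p] smooth_along_has_derivative_within[OF V p]] refl]
  by (simp add: D_at_def fun_deriv_def cvec.scale_right_distrib cvec.scale_left_distrib mult.commute)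

lemma fun_deriv_mult:
  assumes p: "p \<in> M" and u: "u \<in> ctangent_space M p"
    and f: "smooth_along M f" and h: "smooth_along M h"
  shows "fun_deriv M u (\<lambda>q. f q * h q) p = f p * fun_deriv M u h p + fun_deriv M u f p * h p"
  using fun_deriv_eq[OF p u smooth_along_bounded_bilinear[OF bounded_bilinear_mult f h]
      bounded_bilinear.FDERIV[OF bounded_bilinear_mult
        smooth_along_has_derivative_within[OF f p] smooth_along_has_derivative_within[OF h p]] refl]
  by (simp add: fun_deriv_def algebra_simps)

lemma fun_deriv_g:
  assumes p: "p \<in> M" and u: "u \<in> ctangent_space M p"
    and V: "smooth_along M V" and W: "smooth_along M W"
  shows "fun_deriv M u (\<lambda>q. g (V q) (W q)) p = g (D_at M u V p) (W p) + g (V p) (D_at M u W p)"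
  using fun_deriv_eq[OF p u smooth_along_bounded_bilinear[OF bounded_bilinear_g V W]
      bounded_bilinear.FDERIV[OF bounded_bilinear_g
        smooth_along_has_derivative_within[OF V p] smooth_along_has_derivative_within[OF W p]] refl]
  by (simp add: D_at_def fun_deriv_def g_simps algebra_simps)

lemma D_at_dir_add:
  assumes p: "p \<in> M" and V: "smooth_along M V"
  shows "D_at M (u + u') V p = D_at M u V p + D_at M u' V p"
  using linear_add[OF has_derivative_linear[OF smooth_along_has_derivative_within[OF V p]]]
  by (simp add: D_at_def cvec.scale_right_distrib)

lemma fun_deriv_dir_add:
  assumes p: "p \<in> M" and f: "smooth_along M f"
  shows "fun_deriv M (u + u') f p = fun_deriv M u f p + fun_deriv M u' f p"
  using linear_add[OF has_derivative_linear[OF smooth_along_has_derivative_within[OF f p]]]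
  by (simp add: fun_deriv_def algebra_simps)

lemma D_at_dir_scale:
  assumes p: "p \<in> M" and V: "smooth_along M V"
  shows "D_at M (c *\<^sub>c u) V p = c *\<^sub>c D_at M u V p"
proof -
  have lin: "linear (frechet_derivative V (at p within M))"
    using has_derivative_linear[OF smooth_along_has_derivative_within[OF V p]] .
  show ?thesis
    by (simp add: D_at_def linear_add[OF lin] linear_diff[OF lin] linear_cmul[OF lin]
        prod_eq_iff algebra_simps)
qed

lemma fun_deriv_dir_scale:
  assumes p: "p \<in> M" and f: "smooth_along M f"
  shows "fun_deriv M (c *\<^sub>c u) f p = c * fun_deriv M u f p"
proof -
  have lin: "linear (frechet_derivative f (at p within M))"
    using has_derivative_linear[OF smooth_along_has_derivative_within[OF f p]] .
  show ?thesis
    by (simp add: fun_deriv_def linear_add[OF lin] linear_diff[OF lin] linear_cmul[OF lin]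
        complex_eq_iff algebra_simps)
qed

lemma D_at_type10:
  assumes p: "p \<in> M" and u: "u \<in> ctangent_space M p" and V: "smooth_along M V"
    and type: "\<And>q. q \<in> M \<Longrightarrow> V q \<in> type10"
  shows "D_at M u V p \<in> type10"
  using D_at_cong[OF p u smooth_along_bounded_linear[OF bounded_linear_J V], of "\<lambda>q. \<i> *\<^sub>c V q"]
    D_at_J[OF p u V] D_at_const_scale[OF p u V, of \<i>] type
  by (simp add: type10_iff)

text \<open>The local extension is the derivative of an extension of \<open>f\<close> in an extended
  direction. Tangency of \<open>X\<close> on \<open>M\<close> makes it coincide there with the
  chosen derivative.\<close>

lemma smooth_along_derivative:
  fixes f :: "complex ^ 'm \<Rightarrow> 'b::euclidean_space"
  assumes f: "smooth_along M f" and X: "smooth_along M X"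
    and tan: "\<And>q. q \<in> M \<Longrightarrow> X q \<in> tangent_space M q"
  shows "smooth_along M (\<lambda>q. frechet_derivative f (at q within M) (X q))"
  unfolding smooth_along_def
proof
  fix p assume "p \<in> M"
  then obtain S h x where S: "p \<in> S" "smooth_on_open S h" "smooth_on_open S x"
    and h: "\<And>q. q \<in> M \<Longrightarrow> q \<in> S \<Longrightarrow> h q = f q" and x: "\<And>q. q \<in> M \<Longrightarrow> q \<in> S \<Longrightarrow> x q = X q"
    using smooth_along_common_extension[OF f X] by blast
  have "frechet_derivative h (at q) (x q) = frechet_derivative f (at q within M) (X q)"
    if q: "q \<in> M" "q \<in> S" for q
    unfolding x[OF q]
  proof (rule has_derivative_agree_on_tangent_space[where S = S, OF tan q(1)])
    show "(h has_derivative frechet_derivative h (at q)) (at q within M)"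
      using smooth_on_open_has_derivative[OF S(2) q(2)] by (rule has_derivative_at_withinI)
    show "(f has_derivative frechet_derivative f (at q within M)) (at q within M)"
      by (rule smooth_along_has_derivative_within[OF f q(1)])
  qed (use q h S in \<open>auto simp: smooth_on_open_def\<close>)
  with S smooth_on_open_derivative_along[OF S(2,3)]
  show "\<exists>S h. p \<in> S \<and> smooth_on_open S h \<and>
      (\<forall>q\<in>M \<inter> S. h q = frechet_derivative f (at q within M) (X q))"
    by blast
qed

section \<open>The Lie bracket as a commutator of flat derivatives\<close>

text \<open>
  Tangency of \<open>D_X Y - D_Y X\<close> and the commutator formula have the same source:
  \<open>X (Y f)\<close> is \<open>df (D_X Y)\<close> plus a symmetric second derivative of an extension \<open>h\<close> of \<open>f\<close>,
  and for \<open>f\<close> a defining function the left-hand side vanishes.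
\<close>

lemma has_derivative_directional:
  fixes h :: "complex ^ 'm \<Rightarrow> 'b::euclidean_space"
  assumes h: "smooth_on_open S h" and p: "p \<in> S" and Y: "(Y has_derivative Y') (at p within M)"
  shows "((\<lambda>q. \<Sum>b\<in>Basis. (Y q \<bullet> b) *\<^sub>R frechet_derivative h (at q) b) has_derivative
    (\<lambda>u. frechet_derivative h (at p) (Y' u) +
      frechet_derivative (\<lambda>q. frechet_derivative h (at q) u) (at p) (Y p))) (at p within M)"
proof -
  let ?d = "frechet_derivative h (at p)"
  let ?D = "\<lambda>a. frechet_derivative (\<lambda>q. frechet_derivative h (at q) a) (at p)"
  have lin: "linear ?d" "linear (?D u)" for u
    using smooth_on_open_has_derivative[OF h p]
      smooth_on_open_has_derivative[OF smooth_on_open_derivative[OF h] p, of u]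
    by (auto intro: has_derivative_linear)
  \<comment> \<open>In the basis the direction of \<open>h\<close> is fixed, so the product rule
    applies to scalar coefficients differentiable within \<open>M\<close>.\<close>
  have "((\<lambda>q. \<Sum>b\<in>Basis. (Y q \<bullet> b) *\<^sub>R frechet_derivative h (at q) b) has_derivative
      (\<lambda>u. \<Sum>b\<in>Basis. (Y p \<bullet> b) *\<^sub>R ?D b u + (Y' u \<bullet> b) *\<^sub>R ?d b)) (at p within M)"
    by (intro has_derivative_sum has_derivative_scaleR has_derivative_inner_left Y
        has_derivative_at_withinI[OF smooth_on_open_has_derivative[OF _ p]]
        smooth_on_open_derivative h)
  \<comment> \<open>Symmetry of second derivatives replaces \<open>?D b u\<close> by
    \<open>?D u b\<close>, which is linear in \<open>b\<close>, so the sum collapses to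
    \<open>?D u (Y p)\<close>.\<close>
  moreover have "(\<Sum>b\<in>Basis. (Y p \<bullet> b) *\<^sub>R ?D b u + (Y' u \<bullet> b) *\<^sub>R ?d b) = ?d (Y' u) + ?D u (Y p)" for u
  proof -
    have "(\<Sum>b\<in>Basis. (Y' u \<bullet> b) *\<^sub>R ?d b) = ?d (\<Sum>b\<in>Basis. (Y' u \<bullet> b) *\<^sub>R b)"
      by (simp add: linear_sum[OF lin(1)] linear_cmul[OF lin(1)])
    moreover have "(\<Sum>b\<in>Basis. (Y p \<bullet> b) *\<^sub>R ?D u b) = ?D u (\<Sum>b\<in>Basis. (Y p \<bullet> b) *\<^sub>R b)"
      by (simp add: linear_sum[OF lin(2)] linear_cmul[OF lin(2)])
    ultimately show ?thesis
      by (simp add: sum.distrib euclidean_representation symmetric_second_derivative[OF h p, of _ u])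
  qed
  ultimately show ?thesis by simp
qed

abbreviation dir ("\<partial>") where
  "\<partial> X f \<equiv> \<lambda>q. frechet_derivative f (at q within M) (X q)"

text \<open>\<open>F\<close> and \<open>G\<close> are left free to fit two uses: they are 0 when
  \<open>h\<close> is a defining function, and the derivatives of \<open>f\<close> within
  \<open>M\<close> when \<open>h\<close> extends \<open>f\<close>. The second derivatives of
  \<open>h\<close> cancel by symmetry.\<close>

lemma smooth_extension_commutator:
  fixes h f F G :: "complex ^ 'm \<Rightarrow> 'b::euclidean_space"
  assumes p: "p \<in> M" "p \<in> S" and h: "smooth_on_open S h"
    and X: "smooth_along M X" "\<And>q. q \<in> M \<Longrightarrow> X q \<in> tangent_space M q"
    and Y: "smooth_along M Y" "\<And>q. q \<in> M \<Longrightarrow> Y q \<in> tangent_space M q"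
    and F: "(F has_derivative F') (at p within M)"
      "\<And>q. q \<in> M \<Longrightarrow> q \<in> S \<Longrightarrow> F q = frechet_derivative h (at q) (Y q)"
    and G: "(G has_derivative G') (at p within M)"
      "\<And>q. q \<in> M \<Longrightarrow> q \<in> S \<Longrightarrow> G q = frechet_derivative h (at q) (X q)"
  shows "F' (X p) - G' (Y p) = frechet_derivative h (at p) (\<partial> X Y p - \<partial> Y X p)"
proof -
  have S: "open S" using h by (simp add: smooth_on_open_def)
  have sum: "frechet_derivative h (at q) v = (\<Sum>b\<in>Basis. (v \<bullet> b) *\<^sub>R frechet_derivative h (at q) b)"
    if "q \<in> S" for q v
  proof -
    have lin: "linear (frechet_derivative h (at q))"
      using smooth_on_open_has_derivative[OF h that] by (rule has_derivative_linear)
    have "frechet_derivative h (at q) (\<Sum>b\<in>Basis. (v \<bullet> b) *\<^sub>R b) =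
        (\<Sum>b\<in>Basis. (v \<bullet> b) *\<^sub>R frechet_derivative h (at q) b)"
      by (simp add: linear_sum[OF lin] linear_cmul[OF lin])
    then show ?thesis by (simp add: euclidean_representation)
  qed
  have "F' (X p) = frechet_derivative h (at p) (\<partial> X Y p) +
      frechet_derivative (\<lambda>q. frechet_derivative h (at q) (X p)) (at p) (Y p)"
    by (rule has_derivative_agree_on_tangent_space[where S = S, OF X(2)[OF p(1)] p(1) F(1)
          has_derivative_directional[OF h p(2) smooth_along_has_derivative_within[OF Y(1) p(1)]]
          S p(2)])
      (use F(2) sum in auto)
  moreover have "G' (Y p) = frechet_derivative h (at p) (\<partial> Y X p) +
      frechet_derivative (\<lambda>q. frechet_derivative h (at q) (Y p)) (at p) (X p)"
    by (rule has_derivative_agree_on_tangent_space[where S = S, OF Y(2)[OF p(1)] p(1) G(1)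
          has_derivative_directional[OF h p(2) smooth_along_has_derivative_within[OF X(1) p(1)]]
          S p(2)])
      (use G(2) sum in auto)
  moreover have "linear (frechet_derivative h (at p))"
    using smooth_on_open_has_derivative[OF h p(2)] by (rule has_derivative_linear)
  ultimately show ?thesis
    using symmetric_second_derivative[OF h p(2), of "X p" "Y p"] by (simp add: linear_diff)
qed

lemma commutator_tangent:
  assumes p: "p \<in> M"
    and X: "smooth_along M X" "\<And>q. q \<in> M \<Longrightarrow> X q \<in> tangent_space M q"
    and Y: "smooth_along M Y" "\<And>q. q \<in> M \<Longrightarrow> Y q \<in> tangent_space M q"
  shows "\<partial> X Y p - \<partial> Y X p \<in> tangent_space M p"
proof -
  obtain S \<rho> where ldf: "local_defining_function M p S \<rho>"
    using hypersurface p by (auto simp: smooth_hypersurface_def)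
  then have S: "p \<in> S" "smooth_on_open S \<rho>" by (auto simp: local_defining_function_def)
  \<comment> \<open>\<open>\<rho>\<close> is a defining function at every point of
    \<open>M \<inter> S\<close>, not only at \<open>p\<close>, so its derivatives along
    \<open>X\<close> and \<open>Y\<close> vanish on all of \<open>M \<inter> S\<close>.\<close>
  have zero: "0 = frechet_derivative \<rho> (at q) v" if "q \<in> M" "q \<in> S" "v \<in> tangent_space M q" for q v
    using that tangent_space_eq_kernel[of M q S \<rho>] ldf by (auto simp: local_defining_function_def)
  have "(\<lambda>_. 0) (X p) - (\<lambda>_. 0) (Y p) = frechet_derivative \<rho> (at p) (\<partial> X Y p - \<partial> Y X p)"
    by (rule smooth_extension_commutator[OF p S X Y, of "\<lambda>_. 0" _ "\<lambda>_. 0"])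
      (use X(2) Y(2) zero in auto)
  then show ?thesis using tangent_space_eq_kernel[OF ldf p] by simp
qed

lemma commutator_derivation:
  fixes f :: "complex ^ 'm \<Rightarrow> 'b::euclidean_space"
  assumes p: "p \<in> M" and f: "smooth_along M f"
    and X: "smooth_along M X" "\<And>q. q \<in> M \<Longrightarrow> X q \<in> tangent_space M q"
    and Y: "smooth_along M Y" "\<And>q. q \<in> M \<Longrightarrow> Y q \<in> tangent_space M q"
  shows "\<partial> X (\<partial> Y f) p - \<partial> Y (\<partial> X f) p =
    frechet_derivative f (at p within M) (\<partial> X Y p - \<partial> Y X p)"
proof -
  obtain S h where S: "p \<in> S" "smooth_on_open S h" and h: "\<And>q. q \<in> M \<Longrightarrow> q \<in> S \<Longrightarrow> h q = f q"
    using smooth_alongE[OF f p] by blast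
  have eq: "frechet_derivative f (at q within M) v = frechet_derivative h (at q) v"
    if "q \<in> M" "q \<in> S" "v \<in> tangent_space M q" for q v
    by (rule has_derivative_agree_on_tangent_space[where S = S, OF that(3,1)
          smooth_along_has_derivative_within[OF f that(1)]
          has_derivative_at_withinI[OF smooth_on_open_has_derivative[OF S(2) that(2)]]])
      (use S h that in \<open>auto simp: smooth_on_open_def\<close>)
  have "\<partial> X (\<partial> Y f) p - \<partial> Y (\<partial> X f) p = frechet_derivative h (at p) (\<partial> X Y p - \<partial> Y X p)"
    by (rule smooth_extension_commutator[where F = "\<partial> Y f" and G = "\<partial> X f", OF p S X Y])
      (use X Y f p eq in \<open>auto intro: smooth_along_has_derivative_within smooth_along_derivative\<close>)
  \<comment> \<open>Passing back from \<open>h\<close> to \<open>f\<close> is legitimate only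
    because the commutator is tangent.\<close>
  then show ?thesis using eq[OF p S(1) commutator_tangent[OF p X Y]] by simp
qed

section \<open>Complex fields through their real and imaginary parts\<close>

lemma section_components:
  assumes "V \<in> sections M (ctangent_space M)"
  shows "smooth_along M (\<lambda>q. fst (V q))" "smooth_along M (\<lambda>q. snd (V q))"
    and "\<And>q. q \<in> M \<Longrightarrow> fst (V q) \<in> tangent_space M q"
    and "\<And>q. q \<in> M \<Longrightarrow> snd (V q) \<in> tangent_space M q"
  using assms
  by (auto simp: sections_def ctangent_space_def mem_Times_iff
      intro!: smooth_along_bounded_linear[OF bounded_linear_fst]
        smooth_along_bounded_linear[OF bounded_linear_snd])

lemma smooth_D_flat:
  assumes U: "U \<in> sections M (ctangent_space M)" and V: "smooth_along M V"
  shows "smooth_along M (D_flat M U V)"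
proof -
  have "smooth_along M (\<lambda>q. \<partial> (\<lambda>q. fst (U q)) V q + \<i> *\<^sub>c \<partial> (\<lambda>q. snd (U q)) V q)"
    using section_components[OF U] V
    by (intro smooth_along_add smooth_along_bounded_bilinear[OF bounded_bilinear_cvec_scale]
        smooth_along_const smooth_along_derivative) auto
  then show ?thesis by (simp add: D_flat_def[abs_def] D_at_def)
qed

lemma smooth_app_field:
  assumes U: "U \<in> sections M (ctangent_space M)" and f: "smooth_along M f"
  shows "smooth_along M (app_field M U f)"
proof -
  have "smooth_along M (\<lambda>q. \<partial> (\<lambda>q. fst (U q)) f q + \<i> * \<partial> (\<lambda>q. snd (U q)) f q)"
    using section_components[OF U] f
    by (intro smooth_along_add smooth_along_bounded_bilinear[OF bounded_bilinear_mult]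
        smooth_along_const smooth_along_derivative) auto
  then show ?thesis by (simp add: app_field_def[abs_def] fun_deriv_def)
qed

lemma app_field_app_field:
  assumes p: "p \<in> M" and U: "U \<in> sections M (ctangent_space M)"
    and V: "V \<in> sections M (ctangent_space M)" and f: "smooth_along M f"
  defines "U1 \<equiv> \<lambda>q. fst (U q)" and "U2 \<equiv> \<lambda>q. snd (U q)"
    and "V1 \<equiv> \<lambda>q. fst (V q)" and "V2 \<equiv> \<lambda>q. snd (V q)"
  shows "app_field M U (app_field M V f) p =
    \<partial> U1 (\<partial> V1 f) p - \<partial> U2 (\<partial> V2 f) p + \<i> * (\<partial> U1 (\<partial> V2 f) p + \<partial> U2 (\<partial> V1 f) p)"
proof -
  have sm: "smooth_along M (\<partial> V1 f)" "smooth_along M (\<partial> V2 f)"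
    using section_components[OF V] f by (auto simp: V1_def V2_def intro: smooth_along_derivative)
  have "((\<lambda>q. \<partial> V1 f q + \<i> * \<partial> V2 f q) has_derivative
      (\<lambda>u. frechet_derivative (\<partial> V1 f) (at p within M) u +
        \<i> * frechet_derivative (\<partial> V2 f) (at p within M) u)) (at p within M)"
    by (intro has_derivative_add has_derivative_mult_right
        smooth_along_has_derivative_within p sm)
  moreover have "U p \<in> ctangent_space M p" using U p by (simp add: sections_def)
  ultimately have "fun_deriv M (U p) (app_field M V f) p =
      frechet_derivative (\<partial> V1 f) (at p within M) (fst (U p)) +
        \<i> * frechet_derivative (\<partial> V2 f) (at p within M) (fst (U p)) +
      \<i> * (frechet_derivative (\<partial> V1 f) (at p within M) (snd (U p)) +
        \<i> * frechet_derivative (\<partial> V2 f) (at p within M) (snd (U p)))"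
    by (intro fun_deriv_eq[OF p _ smooth_app_field[OF V f]]) (auto simp: app_field_def fun_deriv_def V1_def V2_def)
  then show ?thesis
    by (simp add: app_field_def[of M U] U1_def U2_def algebra_simps)
qed

lemma D_flat_components:
  assumes p: "p \<in> M" and U: "U \<in> sections M (ctangent_space M)"
    and V: "V \<in> sections M (ctangent_space M)"
  defines "U1 \<equiv> \<lambda>q. fst (U q)" and "U2 \<equiv> \<lambda>q. snd (U q)"
    and "V1 \<equiv> \<lambda>q. fst (V q)" and "V2 \<equiv> \<lambda>q. snd (V q)"
  shows "fst (D_flat M U V p) = \<partial> U1 V1 p - \<partial> U2 V2 p"
    and "snd (D_flat M U V p) = \<partial> U1 V2 p + \<partial> U2 V1 p"
proof -
  have V': "smooth_along M V" using V by (simp add: sections_def)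
  have "((\<lambda>q. (fst (V q), snd (V q))) has_derivative
      (\<lambda>u. (frechet_derivative V1 (at p within M) u, frechet_derivative V2 (at p within M) u)))
      (at p within M)"
    using section_components(1,2)[OF V] p unfolding V1_def V2_def
    by (intro has_derivative_Pair smooth_along_has_derivative_within)
  moreover have "U p \<in> ctangent_space M p" using U p by (simp add: sections_def)
  ultimately have "D_flat M U V p =
      (\<partial> U1 V1 p, \<partial> U1 V2 p) + \<i> *\<^sub>c (\<partial> U2 V1 p, \<partial> U2 V2 p)"
    unfolding D_flat_def U1_def U2_def by (intro D_at_eq[OF p _ V']) auto
  then show "fst (D_flat M U V p) = \<partial> U1 V1 p - \<partial> U2 V2 p"
    "snd (D_flat M U V p) = \<partial> U1 V2 p + \<partial> U2 V1 p" by simp_all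
qed

text \<open>Coordinate functions recover a complexified tangent vector from its action on functions;
  this gives the uniqueness in the definition of the bracket.\<close>

lemma fun_deriv_coordinate:
  assumes p: "p \<in> M" and w: "w \<in> ctangent_space M p"
  shows "smooth_along M (\<lambda>q. complex_of_real (q \<bullet> b))"
    and "fun_deriv M w (\<lambda>q. of_real (q \<bullet> b)) p = Complex (fst w \<bullet> b) (snd w \<bullet> b)"
proof -
  have lin: "bounded_linear (\<lambda>q. complex_of_real (q \<bullet> b))"
    by (intro bounded_linear_compose[OF bounded_linear_of_real] bounded_linear_inner_left)
  show smooth: "smooth_along M (\<lambda>q. complex_of_real (q \<bullet> b))"
    by (rule smooth_along_bounded_linear[OF lin smooth_along_ident])
  from fun_deriv_eq[OF p w smooth bounded_linear.has_derivative[OF lin has_derivative_ident] refl]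
  show "fun_deriv M w (\<lambda>q. of_real (q \<bullet> b)) p = Complex (fst w \<bullet> b) (snd w \<bullet> b)"
    by (simp add: complex_eq_iff)
qed

lemma lie_bracket_eq:
  assumes p: "p \<in> M" and U: "U \<in> sections M (ctangent_space M)"
    and V: "V \<in> sections M (ctangent_space M)"
  shows "lie_bracket M U V p = D_flat M U V p - D_flat M V U p"
    and "D_flat M U V p - D_flat M V U p \<in> ctangent_space M p"
proof -
  define U1 U2 V1 V2 where UV_defs: "U1 = (\<lambda>q. fst (U q))" "U2 = (\<lambda>q. snd (U q))"
    "V1 = (\<lambda>q. fst (V q))" "V2 = (\<lambda>q. snd (V q))"
  define w where "w = D_flat M U V p - D_flat M V U p"
  note u = section_components[OF U, folded UV_defs] and v = section_components[OF V, folded UV_defs]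
  have u_tan: "q \<in> M \<Longrightarrow> U1 q \<in> tangent_space M q" "q \<in> M \<Longrightarrow> U2 q \<in> tangent_space M q"
    "q \<in> M \<Longrightarrow> V1 q \<in> tangent_space M q" "q \<in> M \<Longrightarrow> V2 q \<in> tangent_space M q" for q
    using section_components(3,4)[OF U] section_components(3,4)[OF V] by (simp_all add: UV_defs)
  have sub: "subspace (tangent_space M p)"
    unfolding tangent_space_eq[OF p] by (rule subspace_hyperplane)
  \<comment> \<open>The brackets of the real and imaginary parts: by complex bilinearity the bracket
    of \<open>U\<close> and \<open>V\<close> is c11 - c22 + i (c12 + c21).\<close>
  define c11 c22 c12 c21 where c_defs: "c11 = \<partial> U1 V1 p - \<partial> V1 U1 p"
    "c22 = \<partial> U2 V2 p - \<partial> V2 U2 p" "c12 = \<partial> U1 V2 p - \<partial> V2 U1 p"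
    "c21 = \<partial> U2 V1 p - \<partial> V1 U2 p"
  have w1: "fst w = c11 - c22" and w2: "snd w = c12 + c21"
    by (simp_all add: w_def c_defs D_flat_components[OF p U V] D_flat_components[OF p V U] UV_defs)
  have "c11 \<in> tangent_space M p" "c22 \<in> tangent_space M p"
    "c12 \<in> tangent_space M p" "c21 \<in> tangent_space M p"
    unfolding c_defs by (intro commutator_tangent p u(1,2) v(1,2) u_tan; assumption)+
  then have w: "w \<in> ctangent_space M p"
    by (simp add: ctangent_space_def mem_Times_iff w1 w2 subspace_add[OF sub] subspace_diff[OF sub])
  then show "D_flat M U V p - D_flat M V U p \<in> ctangent_space M p" by (simp only: w_def)
  have deriv: "fun_deriv M w f p = app_field M U (app_field M V f) p - app_field M V (app_field M U f) p"
    if f: "smooth_along M f" for f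
  proof -
    let ?L = "frechet_derivative f (at p within M)"
    have lin: "linear ?L"
      using smooth_along_has_derivative_within[OF f p] by (rule has_derivative_linear)
    have com: "\<partial> U1 (\<partial> V1 f) p - \<partial> V1 (\<partial> U1 f) p = ?L c11" "\<partial> U2 (\<partial> V2 f) p - \<partial> V2 (\<partial> U2 f) p = ?L c22"
      "\<partial> U1 (\<partial> V2 f) p - \<partial> V2 (\<partial> U1 f) p = ?L c12" "\<partial> U2 (\<partial> V1 f) p - \<partial> V1 (\<partial> U2 f) p = ?L c21"
      unfolding c_defs by (intro commutator_derivation p f u(1,2) v(1,2) u_tan; assumption)+
    have w_deriv: "fun_deriv M w f p = ?L c11 - ?L c22 + \<i> * (?L c12 + ?L c21)"
      by (simp only: fun_deriv_def w1 w2 linear_diff[OF lin] linear_add[OF lin])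
    have UV: "app_field M U (app_field M V f) p =
        \<partial> U1 (\<partial> V1 f) p - \<partial> U2 (\<partial> V2 f) p + \<i> * (\<partial> U1 (\<partial> V2 f) p + \<partial> U2 (\<partial> V1 f) p)"
      unfolding UV_defs by (rule app_field_app_field[OF p U V f])
    have VU: "app_field M V (app_field M U f) p =
        \<partial> V1 (\<partial> U1 f) p - \<partial> V2 (\<partial> U2 f) p + \<i> * (\<partial> V1 (\<partial> U2 f) p + \<partial> V2 (\<partial> U1 f) p)"
      unfolding UV_defs by (rule app_field_app_field[OF p V U f])
    have "a - b - (c - d) + \<i> * (x - y + (z - t)) =
        (a - c + \<i> * (x + z)) - (b - d + \<i> * (t + y))" for a b c d x y z t :: complex
      by (simp add: algebra_simps)
    then show ?thesis unfolding w_deriv UV VU com[symmetric] .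
  qed
  show "lie_bracket M U V p = D_flat M U V p - D_flat M V U p"
    unfolding lie_bracket_def w_def[symmetric]
  proof (rule the_equality)
    show "w \<in> ctangent_space M p \<and> (\<forall>f. smooth_along M f \<longrightarrow>
        fun_deriv M w f p = app_field M U (app_field M V f) p - app_field M V (app_field M U f) p)"
      using w deriv by blast
  next
    fix w'
    assume w': "w' \<in> ctangent_space M p \<and> (\<forall>f. smooth_along M f \<longrightarrow>
        fun_deriv M w' f p = app_field M U (app_field M V f) p - app_field M V (app_field M U f) p)"
    have "Complex (fst w' \<bullet> b) (snd w' \<bullet> b) = Complex (fst w \<bullet> b) (snd w \<bullet> b)" for b
    proof -
      note smooth = fun_deriv_coordinate(1)[OF p w, of b]
      have "fun_deriv M w' (\<lambda>q. of_real (q \<bullet> b)) p = fun_deriv M w (\<lambda>q. of_real (q \<bullet> b)) p"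
        unfolding deriv[OF smooth] using w' smooth by blast
      then show ?thesis
        unfolding fun_deriv_coordinate(2)[OF p w] fun_deriv_coordinate(2)[OF p conjunct1[OF w']] .
    qed
    then have "fst w' = fst w" "snd w' = snd w"
      by (auto intro: euclidean_eqI)
    then show "w' = w" by (rule prod_eqI)
  qed
qed

section \<open>The connection\<close>

lemma section_ctangent:
  assumes "V \<in> sections M E" "\<And>p. p \<in> M \<Longrightarrow> E p \<subseteq> ctangent_space M p"
  shows "V \<in> sections M (ctangent_space M)"
  using assms by (auto simp: sections_def)

lemma hol_section_ctangent:
  "V \<in> sections M (hol_tangent M) \<Longrightarrow> V \<in> sections M (ctangent_space M)"
  "V \<in> sections M (antihol_tangent M) \<Longrightarrow> V \<in> sections M (ctangent_space M)"
  by (auto intro: section_ctangent hol_tangent_ctangent antihol_tangent_ctangent)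

lemma smooth_scale:
  "smooth_along M f \<Longrightarrow> smooth_along M V \<Longrightarrow> smooth_along M (\<lambda>q. f q *\<^sub>c V q)"
  by (rule smooth_along_bounded_bilinear[OF bounded_bilinear_cvec_scale])

lemmas smooth_mult = smooth_along_bounded_bilinear[OF bounded_bilinear_mult]
lemmas smooth_g = smooth_along_bounded_bilinear[OF bounded_bilinear_g]
lemmas smooth_J = smooth_along_bounded_linear[OF bounded_linear_J]
lemmas smooth_cvec_cnj = smooth_along_bounded_linear[OF bounded_linear_cvec_cnj]

lemma smooth_T_field: "smooth_along M (T_field \<nu>)"
  and smooth_N_field: "smooth_along M (N_field \<nu>)"
proof -
  have "bounded_linear (cvec_of_real :: complex ^ 'm \<Rightarrow> 'm cvec)"
    unfolding cvec_of_real_def[abs_def]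
    by (intro bounded_linear_Pair bounded_linear_ident bounded_linear_zero)
  then have \<nu>: "smooth_along M (\<lambda>q. cvec_of_real (\<nu> q))"
    by (rule smooth_along_bounded_linear) (rule smooth_normal)
  from smooth_J[OF this] show T: "smooth_along M (T_field \<nu>)"
    by (simp add: T_field_def[abs_def])
  show "smooth_along M (N_field \<nu>)"
    unfolding N_field_def[abs_def]
    by (intro smooth_scale smooth_along_diff smooth_along_const \<nu> T)
qed

lemma smooth_parts:
  assumes V: "smooth_along M V"
  shows "smooth_along M (\<lambda>q. hol_part \<nu> q (V q))" "smooth_along M (\<lambda>q. antihol_part \<nu> q (V q))"
  unfolding hol_part_def levi_part_def antihol_part_def
  by (intro smooth_scale smooth_along_diff smooth_along_add smooth_along_const smooth_J smooth_g
      smooth_T_field V)+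

lemma smooth_proj:
  assumes V: "smooth_along M V"
  shows "smooth_along M (\<lambda>q. hol_proj \<nu> q (V q))" "smooth_along M (\<lambda>q. antihol_proj \<nu> q (V q))"
  unfolding hol_proj_def antihol_proj_def
  by (intro smooth_scale smooth_along_diff smooth_g smooth_cvec_cnj smooth_N_field V)+

lemma cvec_cnj_section:
  "V \<in> sections M (ctangent_space M) \<Longrightarrow> (\<lambda>q. cvec_cnj (V q)) \<in> sections M (ctangent_space M)"
  "V \<in> sections M (hol_tangent M) \<Longrightarrow> (\<lambda>q. cvec_cnj (V q)) \<in> sections M (antihol_tangent M)"
  "V \<in> sections M (antihol_tangent M) \<Longrightarrow> (\<lambda>q. cvec_cnj (V q)) \<in> sections M (hol_tangent M)"
  by (auto simp: sections_def smooth_cvec_cnj ctangent_space_cnj antihol_tangent_iff)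

lemma section_add:
  assumes "V \<in> sections M E" "W \<in> sections M E"
    and "\<And>p v w. p \<in> M \<Longrightarrow> v \<in> E p \<Longrightarrow> w \<in> E p \<Longrightarrow> v + w \<in> E p"
  shows "(\<lambda>q. V q + W q) \<in> sections M E"
  using assms by (auto simp: sections_def intro: smooth_along_add)

lemma section_scale:
  assumes "smooth_along M f" "V \<in> sections M E"
    and "\<And>p v c. p \<in> M \<Longrightarrow> v \<in> E p \<Longrightarrow> c *\<^sub>c v \<in> E p"
  shows "(\<lambda>q. f q *\<^sub>c V q) \<in> sections M E"
  using assms by (auto simp: sections_def intro: smooth_scale)

lemma hol_tangent_add:
  "p \<in> M \<Longrightarrow> v \<in> hol_tangent M p \<Longrightarrow> w \<in> hol_tangent M p \<Longrightarrow> v + w \<in> hol_tangent M p"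
  by (simp add: hol_tangent_iff g_simps type10_iff J_add cvec.scale_right_distrib)

lemma hol_tangent_scale:
  "p \<in> M \<Longrightarrow> v \<in> hol_tangent M p \<Longrightarrow> c *\<^sub>c v \<in> hol_tangent M p"
  by (simp add: hol_tangent_iff g_simps type10_iff J_scale mult.commute)

lemma antihol_tangent_add:
  "p \<in> M \<Longrightarrow> v \<in> antihol_tangent M p \<Longrightarrow> w \<in> antihol_tangent M p \<Longrightarrow> v + w \<in> antihol_tangent M p"
  by (simp add: antihol_tangent_iff cvec_cnj_add hol_tangent_add)

lemma antihol_tangent_scale:
  "p \<in> M \<Longrightarrow> v \<in> antihol_tangent M p \<Longrightarrow> c *\<^sub>c v \<in> antihol_tangent M p"
  by (simp add: antihol_tangent_iff cvec_cnj_scale hol_tangent_scale)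

lemma D_flat_hol_proj:
  assumes p: "p \<in> M" and U: "U \<in> sections M (ctangent_space M)"
  shows "Z \<in> sections M (hol_tangent M) \<Longrightarrow> D_flat M U Z p \<in> type10"
    and "B \<in> sections M (antihol_tangent M) \<Longrightarrow> cvec_cnj (D_flat M U B p) \<in> type10"
    and "Z \<in> sections M (hol_tangent M) \<Longrightarrow> hol_proj \<nu> p (D_flat M U Z p) \<in> hol_tangent M p"
    and "B \<in> sections M (antihol_tangent M) \<Longrightarrow>
      antihol_proj \<nu> p (D_flat M U B p) \<in> antihol_tangent M p"
proof -
  have u: "U p \<in> ctangent_space M p" using U p by (simp add: sections_def)
  then have u': "cvec_cnj (U p) \<in> ctangent_space M p" using p by (simp add: ctangent_space_cnj)
  show 1: "D_flat M U Z p \<in> type10" if "Z \<in> sections M (hol_tangent M)"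
    unfolding D_flat_def using that p u
    by (intro D_at_type10) (auto simp: sections_def hol_tangent_def)
  show 2: "cvec_cnj (D_flat M U B p) \<in> type10" if B: "B \<in> sections M (antihol_tangent M)"
  proof -
    \<comment> \<open>Conjugating the derivative of \<open>B\<close> conjugates the direction as
      well, which reduces the claim to a field of type (1,0) differentiated along conj U.\<close>
    have "D_at M (cvec_cnj (U p)) (\<lambda>q. cvec_cnj (B q)) p \<in> type10"
      using cvec_cnj_section(3)[OF B] p u'
      by (intro D_at_type10) (auto simp: sections_def hol_tangent_def)
    then show ?thesis
      using D_at_cnj[OF p u, of B] B by (simp add: D_flat_def sections_def)
  qed
  have hol: "hol_proj \<nu> p v \<in> hol_tangent M p" if "v \<in> type10" for v
    using that p hol_proj_type10 hol_proj_orthogonal_normal[of \<nu> p, OF inner_normal[OF p]]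
    by (simp add: hol_tangent_iff)
  show "hol_proj \<nu> p (D_flat M U Z p) \<in> hol_tangent M p" if "Z \<in> sections M (hol_tangent M)"
    by (rule hol[OF 1[OF that]])
  show "antihol_proj \<nu> p (D_flat M U B p) \<in> antihol_tangent M p"
    if "B \<in> sections M (antihol_tangent M)"
    using hol[OF 2[OF that]] by (simp add: antihol_tangent_iff cvec_cnj_antihol_proj)
qed

text \<open>
  All properties of the connection are read off from this formula, which holds for whichever
  decomposition \<open>V = Z + B + f T\<close> is at hand.
\<close>

lemma nabla_decomposition:
  assumes p: "p \<in> M" and U: "U \<in> sections M (ctangent_space M)"
    and Z: "Z \<in> sections M (hol_tangent M)" and B: "B \<in> sections M (antihol_tangent M)"
    and f: "smooth_along M f"
    and V: "\<And>q. q \<in> M \<Longrightarrow> V q = Z q + B q + f q *\<^sub>c T_field \<nu> q"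
  shows "nabla M \<nu> U V p = hol_proj \<nu> p (D_flat M U Z p) + antihol_proj \<nu> p (D_flat M U B p) +
    app_field M U f p *\<^sub>c T_field \<nu> p"
proof -
  have u: "U p \<in> ctangent_space M p" using U p by (simp add: sections_def)
  have split: "split_at M \<nu> q (V q) = (Z q, cvec_cnj (B q), f q)" if q: "q \<in> M" for q
  proof -
    have ZB: "Z q \<in> hol_tangent M q" "B q \<in> antihol_tangent M q"
      using Z B q by (simp_all add: sections_def)
    have "V q \<in> ctangent_space M q"
      unfolding V[OF q] using q ZB
      by (intro ctangent_space_add ctangent_space_scale T_field_ctangent hol_tangent_ctangent
          antihol_tangent_ctangent)
    then show ?thesis using split_at_eq[OF q] split_unique[OF q ZB V[OF q]] by simp
  qed
  have eqs: "D_at M (U p) (\<lambda>q. fst (split_at M \<nu> q (V q))) p = D_at M (U p) Z p"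
    "D_at M (U p) (\<lambda>q. cvec_cnj (fst (snd (split_at M \<nu> q (V q))))) p = D_at M (U p) B p"
    "fun_deriv M (U p) (\<lambda>q. snd (snd (split_at M \<nu> q (V q)))) p = fun_deriv M (U p) f p"
    using Z B f split
    by (auto simp: sections_def intro!: D_at_cong[OF p u, symmetric] fun_deriv_cong[OF p u, symmetric])
  show ?thesis
    unfolding nabla_def Let_def hol_proj_def antihol_proj_def D_flat_def app_field_def eqs
    by (simp add: algebra_simps)
qed

lemma decomposition:
  assumes V: "V \<in> sections M (ctangent_space M)"
  obtains Z B f where "Z \<in> sections M (hol_tangent M)" "B \<in> sections M (antihol_tangent M)"
    "smooth_along M f" "\<And>q. q \<in> M \<Longrightarrow> V q = Z q + B q + f q *\<^sub>c T_field \<nu> q"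
proof (rule that)
  have V': "smooth_along M V" "\<And>q. q \<in> M \<Longrightarrow> V q \<in> ctangent_space M q"
    using V by (auto simp: sections_def)
  show "(\<lambda>q. hol_part \<nu> q (V q)) \<in> sections M (hol_tangent M)"
    "(\<lambda>q. antihol_part \<nu> q (V q)) \<in> sections M (antihol_tangent M)"
    using V' smooth_parts hol_part_tangent by (auto simp: sections_def)
  show "smooth_along M (\<lambda>q. g (V q) (T_field \<nu> q))"
    by (intro smooth_g V' smooth_T_field)
  show "V q = hol_part \<nu> q (V q) + antihol_part \<nu> q (V q) + g (V q) (T_field \<nu> q) *\<^sub>c T_field \<nu> q"
    for q by (simp add: parts_sum)
qed

lemma zero_section:
  "(\<lambda>q. 0) \<in> sections M (hol_tangent M)" "(\<lambda>q. 0) \<in> sections M (antihol_tangent M)"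
  by (auto simp: sections_def smooth_along_const hol_tangent_iff antihol_tangent_iff type10_iff
      g.zero_left linear_0[OF linear_J] linear_0[OF linear_cvec_cnj])

lemma D_flat_zero:
  assumes "p \<in> M" "U \<in> sections M (ctangent_space M)"
  shows "D_flat M U (\<lambda>q. 0) p = 0" "app_field M U (\<lambda>q. 0) p = 0"
  using D_at_const_scale[of p "U p" "\<lambda>q. 0" 0] fun_deriv_mult[of p "U p" "\<lambda>q. 0" "\<lambda>q. 0"] assms
  by (simp_all add: sections_def D_flat_def app_field_def smooth_along_const)

lemma nabla_hol:
  assumes p: "p \<in> M" and U: "U \<in> sections M (ctangent_space M)"
    and Z: "Z \<in> sections M (hol_tangent M)"
  shows "nabla M \<nu> U Z p = hol_proj \<nu> p (D_flat M U Z p)"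
  using nabla_decomposition[OF p U Z zero_section(2) smooth_along_const, of Z 0]
  by (simp add: D_flat_zero[OF p U])

lemma nabla_antihol:
  assumes p: "p \<in> M" and U: "U \<in> sections M (ctangent_space M)"
    and B: "B \<in> sections M (antihol_tangent M)"
  shows "nabla M \<nu> U B p = antihol_proj \<nu> p (D_flat M U B p)"
  using nabla_decomposition[OF p U zero_section(1) B smooth_along_const, of B 0]
  by (simp add: D_flat_zero[OF p U])

section \<open>The axioms of a connection\<close>

lemma nabla_section:
  assumes U: "U \<in> sections M (ctangent_space M)" and V: "V \<in> sections M (ctangent_space M)"
  shows "nabla M \<nu> U V \<in> sections M (ctangent_space M)"
proof -
  obtain Z B f where Z: "Z \<in> sections M (hol_tangent M)" and B: "B \<in> sections M (antihol_tangent M)"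
    and f: "smooth_along M f" and V: "\<And>q. q \<in> M \<Longrightarrow> V q = Z q + B q + f q *\<^sub>c T_field \<nu> q"
    using decomposition[OF V] by blast
  have eq: "nabla M \<nu> U V p = hol_proj \<nu> p (D_flat M U Z p) + antihol_proj \<nu> p (D_flat M U B p) +
      app_field M U f p *\<^sub>c T_field \<nu> p" if "p \<in> M" for p
    by (rule nabla_decomposition[OF that U Z B f V])
  have "smooth_along M Z" "smooth_along M B" using Z B by (auto simp: sections_def)
  then have "smooth_along M (\<lambda>p. hol_proj \<nu> p (D_flat M U Z p) + antihol_proj \<nu> p (D_flat M U B p) +
      app_field M U f p *\<^sub>c T_field \<nu> p)"
    using U f by (intro smooth_along_add smooth_proj smooth_scale smooth_T_field smooth_D_flat
        smooth_app_field)
  then have "smooth_along M (nabla M \<nu> U V)" by (rule smooth_along_cong) (simp add: eq)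
  moreover have "nabla M \<nu> U V p \<in> ctangent_space M p" if p: "p \<in> M" for p
    unfolding eq[OF p] using p D_flat_hol_proj(3)[OF p U Z] D_flat_hol_proj(4)[OF p U B]
    by (intro ctangent_space_add ctangent_space_scale T_field_ctangent hol_tangent_ctangent
        antihol_tangent_ctangent)
  ultimately show ?thesis by (simp add: sections_def)
qed

text \<open>One decomposition serves both fields, because \<open>nabla_decomposition\<close> asks
  for the equation on \<open>M\<close> only.\<close>

lemma nabla_cong:
  assumes U: "U \<in> sections M (ctangent_space M)" "U' \<in> sections M (ctangent_space M)"
    and V: "V \<in> sections M (ctangent_space M)"
    and eq: "\<forall>p\<in>M. U p = U' p \<and> V p = V' p" and p: "p \<in> M"
  shows "nabla M \<nu> U V p = nabla M \<nu> U' V' p"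
proof -
  obtain Z B f where ZBf: "Z \<in> sections M (hol_tangent M)" "B \<in> sections M (antihol_tangent M)"
    "smooth_along M f" and V: "\<And>q. q \<in> M \<Longrightarrow> V q = Z q + B q + f q *\<^sub>c T_field \<nu> q"
    using decomposition[OF V] by blast
  show ?thesis
    using nabla_decomposition[OF p U(1) ZBf V] nabla_decomposition[OF p U(2) ZBf, of V'] V eq p
    by (simp add: D_flat_def app_field_def)
qed

lemma nabla_dir_add:
  assumes U: "U \<in> sections M (ctangent_space M)" "U' \<in> sections M (ctangent_space M)"
    and V: "V \<in> sections M (ctangent_space M)" and p: "p \<in> M"
  shows "nabla M \<nu> (\<lambda>q. U q + U' q) V p = nabla M \<nu> U V p + nabla M \<nu> U' V p"
proof -
  obtain Z B f where ZBf: "Z \<in> sections M (hol_tangent M)" "B \<in> sections M (antihol_tangent M)"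
    "smooth_along M f" and V: "\<And>q. q \<in> M \<Longrightarrow> V q = Z q + B q + f q *\<^sub>c T_field \<nu> q"
    using decomposition[OF V] by blast
  have "smooth_along M Z" "smooth_along M B" using ZBf by (auto simp: sections_def)
  then show ?thesis
    using nabla_decomposition[OF p _ ZBf V] U section_add[OF U ctangent_space_add] p ZBf(3)
    by (simp add: D_flat_def app_field_def D_at_dir_add fun_deriv_dir_add hol_proj_add
        antihol_proj_add cvec.scale_left_distrib)
qed

lemma nabla_dir_scale:
  assumes h: "smooth_along M h" and U: "U \<in> sections M (ctangent_space M)"
    and V: "V \<in> sections M (ctangent_space M)" and p: "p \<in> M"
  shows "nabla M \<nu> (\<lambda>q. h q *\<^sub>c U q) V p = h p *\<^sub>c nabla M \<nu> U V p"
proof -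
  obtain Z B f where ZBf: "Z \<in> sections M (hol_tangent M)" "B \<in> sections M (antihol_tangent M)"
    "smooth_along M f" and V: "\<And>q. q \<in> M \<Longrightarrow> V q = Z q + B q + f q *\<^sub>c T_field \<nu> q"
    using decomposition[OF V] by blast
  have "smooth_along M Z" "smooth_along M B" using ZBf by (auto simp: sections_def)
  then show ?thesis
    using nabla_decomposition[OF p _ ZBf V] U section_scale[OF h U ctangent_space_scale] p ZBf(3)
    by (simp add: D_flat_def app_field_def D_at_dir_scale fun_deriv_dir_scale hol_proj_scale
        antihol_proj_scale cvec.scale_right_distrib)
qed

lemma nabla_add:
  assumes U: "U \<in> sections M (ctangent_space M)" and V: "V \<in> sections M (ctangent_space M)"
    and V': "V' \<in> sections M (ctangent_space M)" and p: "p \<in> M"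
  shows "nabla M \<nu> U (\<lambda>q. V q + V' q) p = nabla M \<nu> U V p + nabla M \<nu> U V' p"
proof -
  obtain Z B f where ZBf: "Z \<in> sections M (hol_tangent M)" "B \<in> sections M (antihol_tangent M)"
    "smooth_along M f" and V: "\<And>q. q \<in> M \<Longrightarrow> V q = Z q + B q + f q *\<^sub>c T_field \<nu> q"
    using decomposition[OF V] by blast
  obtain Z' B' f' where ZBf': "Z' \<in> sections M (hol_tangent M)" "B' \<in> sections M (antihol_tangent M)"
    "smooth_along M f'" and V': "\<And>q. q \<in> M \<Longrightarrow> V' q = Z' q + B' q + f' q *\<^sub>c T_field \<nu> q"
    using decomposition[OF V'] by blast
  have u: "U p \<in> ctangent_space M p" using U p by (simp add: sections_def)
  have sm: "smooth_along M Z" "smooth_along M B" "smooth_along M Z'" "smooth_along M B'"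
    using ZBf ZBf' by (auto simp: sections_def)
  have "nabla M \<nu> U (\<lambda>q. V q + V' q) p =
      hol_proj \<nu> p (D_flat M U (\<lambda>q. Z q + Z' q) p) +
      antihol_proj \<nu> p (D_flat M U (\<lambda>q. B q + B' q) p) +
      app_field M U (\<lambda>q. f q + f' q) p *\<^sub>c T_field \<nu> p"
    by (rule nabla_decomposition[OF p U section_add[OF ZBf(1) ZBf'(1) hol_tangent_add]
          section_add[OF ZBf(2) ZBf'(2) antihol_tangent_add] smooth_along_add[OF ZBf(3) ZBf'(3)]])
      (simp_all add: V V' cvec.scale_left_distrib)
  then show ?thesis
    using nabla_decomposition[OF p U ZBf V] nabla_decomposition[OF p U ZBf' V'] sm ZBf(3) ZBf'(3)
    by (simp add: D_flat_def app_field_def D_at_add[OF p u] fun_deriv_add[OF p u] hol_proj_add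
        antihol_proj_add cvec.scale_left_distrib)
qed

text \<open>The coefficient to be removed is zero: type kills g(v, N), tangency kills g(v, \<nu>),
  and together they kill g(v, conj N). The second claim is the conjugate.\<close>

lemma hol_proj_hol:
  assumes p: "p \<in> M"
  shows "v \<in> hol_tangent M p \<Longrightarrow> hol_proj \<nu> p v = v"
    and "w \<in> antihol_tangent M p \<Longrightarrow> antihol_proj \<nu> p w = w"
proof -
  show 1: "hol_proj \<nu> p v = v" if v: "v \<in> hol_tangent M p" for v
  proof -
    have "g v (cvec_of_real (\<nu> p)) = 0" "g v (N_field \<nu> p) = 0"
      using v p g_type10_type10[OF _ N_field_type10, of v \<nu> p] by (simp_all add: hol_tangent_iff)
    then have "g v (cvec_cnj (N_field \<nu> p)) = 0"
      by (simp add: normal_eq_N_field g_simps)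
    then show ?thesis by (simp add: hol_proj_def)
  qed
  show "antihol_proj \<nu> p w = w" if "w \<in> antihol_tangent M p"
    using 1[of "cvec_cnj w"] that by (metis antihol_tangent_iff cvec_cnj_cnj cvec_cnj_hol_proj)
qed

text \<open>The extra terms (U h) Z and (U h) B are tangent, hence fixed by the projections, and
  together with (U h) f T they add up to (U h) V.\<close>

lemma nabla_scale:
  assumes h: "smooth_along M h" and U: "U \<in> sections M (ctangent_space M)"
    and V: "V \<in> sections M (ctangent_space M)" and p: "p \<in> M"
  shows "nabla M \<nu> U (\<lambda>q. h q *\<^sub>c V q) p = app_field M U h p *\<^sub>c V p + h p *\<^sub>c nabla M \<nu> U V p"
proof -
  obtain Z B f where ZBf: "Z \<in> sections M (hol_tangent M)" "B \<in> sections M (antihol_tangent M)"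
    "smooth_along M f" and V: "\<And>q. q \<in> M \<Longrightarrow> V q = Z q + B q + f q *\<^sub>c T_field \<nu> q"
    using decomposition[OF V] by blast
  have u: "U p \<in> ctangent_space M p" using U p by (simp add: sections_def)
  have sm: "smooth_along M Z" "smooth_along M B"
    and ZBp: "Z p \<in> hol_tangent M p" "B p \<in> antihol_tangent M p"
    using ZBf p by (auto simp: sections_def)
  have "nabla M \<nu> U (\<lambda>q. h q *\<^sub>c V q) p =
      hol_proj \<nu> p (D_flat M U (\<lambda>q. h q *\<^sub>c Z q) p) +
      antihol_proj \<nu> p (D_flat M U (\<lambda>q. h q *\<^sub>c B q) p) +
      app_field M U (\<lambda>q. h q * f q) p *\<^sub>c T_field \<nu> p"
    by (rule nabla_decomposition[OF p U section_scale[OF h ZBf(1) hol_tangent_scale]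
          section_scale[OF h ZBf(2) antihol_tangent_scale] smooth_mult[OF h ZBf(3)]])
      (simp_all add: V cvec.scale_right_distrib)
  also have "\<dots> = app_field M U h p *\<^sub>c V p + h p *\<^sub>c
      (hol_proj \<nu> p (D_flat M U Z p) + antihol_proj \<nu> p (D_flat M U B p) +
       app_field M U f p *\<^sub>c T_field \<nu> p)"
    using sm ZBf(3) h V[OF p]
    by (simp add: D_flat_def app_field_def D_at_scale[OF p u] fun_deriv_mult[OF p u] hol_proj_add
        antihol_proj_add hol_proj_scale antihol_proj_scale hol_proj_hol[OF p] ZBp
        cvec.scale_left_distrib cvec.scale_right_distrib)
  finally show ?thesis using nabla_decomposition[OF p U ZBf V] by simp
qed

section \<open>The connection theorem, compatibility with conjugation, J and g, and torsion\<close>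

theorem complex_connection_nabla: "complex_connection M (nabla M \<nu>)"
  unfolding complex_connection_def Let_def
  by (intro conjI ballI allI impI nabla_section nabla_cong nabla_dir_add nabla_dir_scale nabla_add
      nabla_scale) auto

text \<open>Conjugation exchanges the roles of \<open>Z\<close> and \<open>B\<close> and of the two
  projections, and fixes the real field T.\<close>

theorem nabla_cnj:
  assumes U: "U \<in> sections M (ctangent_space M)" and V: "V \<in> sections M (ctangent_space M)"
    and p: "p \<in> M"
  shows "cvec_cnj (nabla M \<nu> U V p) = nabla M \<nu> (\<lambda>q. cvec_cnj (U q)) (\<lambda>q. cvec_cnj (V q)) p"
proof -
  obtain Z B f where ZBf: "Z \<in> sections M (hol_tangent M)" "B \<in> sections M (antihol_tangent M)"
    "smooth_along M f" and V: "\<And>q. q \<in> M \<Longrightarrow> V q = Z q + B q + f q *\<^sub>c T_field \<nu> q"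
    using decomposition[OF V] by blast
  have u: "U p \<in> ctangent_space M p" using U p by (simp add: sections_def)
  have sm: "smooth_along M Z" "smooth_along M B" using ZBf by (auto simp: sections_def)
  have "nabla M \<nu> (\<lambda>q. cvec_cnj (U q)) (\<lambda>q. cvec_cnj (V q)) p =
      hol_proj \<nu> p (D_flat M (\<lambda>q. cvec_cnj (U q)) (\<lambda>q. cvec_cnj (B q)) p) +
      antihol_proj \<nu> p (D_flat M (\<lambda>q. cvec_cnj (U q)) (\<lambda>q. cvec_cnj (Z q)) p) +
      app_field M (\<lambda>q. cvec_cnj (U q)) (\<lambda>q. cnj (f q)) p *\<^sub>c T_field \<nu> p"
    by (rule nabla_decomposition[OF p cvec_cnj_section(1)[OF U] cvec_cnj_section(3)[OF ZBf(2)]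
          cvec_cnj_section(2)[OF ZBf(1)] smooth_along_bounded_linear[OF bounded_linear_cnj ZBf(3)]])
      (simp add: V cvec_cnj_add cvec_cnj_scale)
  then show ?thesis
    using nabla_decomposition[OF p U ZBf V] sm ZBf(3)
    by (simp add: D_flat_def app_field_def D_at_cnj[OF p u] fun_deriv_cnj[OF p u] cvec_cnj_add
        cvec_cnj_scale cvec_cnj_hol_proj cvec_cnj_antihol_proj)
qed

text \<open>Without T component, \<open>J\<close> multiplies \<open>Z\<close> by i and
  \<open>B\<close> by -i, constants that pass through D and the projections. On T the claim would
  make no sense, as J T = -\<nu> is not tangent.\<close>

theorem nabla_J:
  assumes U: "U \<in> sections M (ctangent_space M)" and V: "V \<in> sections M (levi_distribution M)"
    and p: "p \<in> M"
  shows "nabla M \<nu> U (\<lambda>q. J (V q)) p = J (nabla M \<nu> U V p)"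
proof -
  have "levi_distribution M q \<subseteq> ctangent_space M q" if "q \<in> M" for q
    unfolding levi_distribution_def
    using that ctangent_space_add hol_tangent_ctangent antihol_tangent_ctangent by blast
  then have Vc: "V \<in> sections M (ctangent_space M)" by (rule section_ctangent[OF V])
  obtain Z B f where ZBf: "Z \<in> sections M (hol_tangent M)" "B \<in> sections M (antihol_tangent M)"
    "smooth_along M f" and dec: "\<And>q. q \<in> M \<Longrightarrow> V q = Z q + B q + f q *\<^sub>c T_field \<nu> q"
    using decomposition[OF Vc] by blast
  have f0: "f q = 0" if q: "q \<in> M" for q
  proof -
    have ZB: "Z q \<in> hol_tangent M q" "B q \<in> antihol_tangent M q"
      using ZBf q by (auto simp: sections_def)
    obtain z w where "V q = z + w" "z \<in> hol_tangent M q" "w \<in> antihol_tangent M q"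
      using V q by (auto simp: sections_def levi_distribution_def)
    then have "g (V q) (T_field \<nu> q) = 0" using q by (simp add: g_simps g_hol_T g_antihol_T)
    with split_unique(3)[OF q ZB dec[OF q]] show ?thesis by simp
  qed
  have u: "U p \<in> ctangent_space M p" using U p by (simp add: sections_def)
  have sm: "smooth_along M Z" "smooth_along M B" using ZBf by (auto simp: sections_def)
  have Jtype: "J (Z q) = \<i> *\<^sub>c Z q" "J (B q) = (- \<i>) *\<^sub>c B q" if q: "q \<in> M" for q
    using ZBf q type01_iff[of "B q"]
    by (auto simp: sections_def hol_tangent_iff antihol_tangent_iff type10_iff)
  have "nabla M \<nu> U V p = hol_proj \<nu> p (D_flat M U Z p) + antihol_proj \<nu> p (D_flat M U B p) +
      app_field M U (\<lambda>q. 0) p *\<^sub>c T_field \<nu> p"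
    by (rule nabla_decomposition[OF p U ZBf(1,2) smooth_along_const]) (simp add: dec f0)
  moreover have "nabla M \<nu> U (\<lambda>q. J (V q)) p =
      hol_proj \<nu> p (D_flat M U (\<lambda>q. \<i> *\<^sub>c Z q) p) +
      antihol_proj \<nu> p (D_flat M U (\<lambda>q. (- \<i>) *\<^sub>c B q) p) + app_field M U (\<lambda>q. 0) p *\<^sub>c T_field \<nu> p"
    by (rule nabla_decomposition[OF p U
          section_scale[OF smooth_along_const ZBf(1) hol_tangent_scale]
          section_scale[OF smooth_along_const ZBf(2) antihol_tangent_scale] smooth_along_const])
      (simp_all add: dec f0 J_add Jtype)
  moreover have "J (hol_proj \<nu> p (D_flat M U Z p)) = \<i> *\<^sub>c hol_proj \<nu> p (D_flat M U Z p)"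
    using D_flat_hol_proj(3)[OF p U ZBf(1)] p by (simp add: hol_tangent_iff type10_iff)
  moreover have "J (antihol_proj \<nu> p (D_flat M U B p)) = (- \<i>) *\<^sub>c antihol_proj \<nu> p (D_flat M U B p)"
    using D_flat_hol_proj(4)[OF p U ZBf(2)] p
    by (simp add: antihol_tangent_iff hol_tangent_iff type01_iff)
  ultimately show ?thesis
    using sm by (simp only: D_flat_zero[OF p U] D_flat_def D_at_const_scale[OF p u] hol_proj_scale
        antihol_proj_scale J_add cvec.scale_zero_left add_0_right)
qed

theorem nabla_parallel:
  assumes U: "U \<in> sections M (ctangent_space M)"
  shows "V \<in> sections M (hol_tangent M) \<Longrightarrow> nabla M \<nu> U V \<in> sections M (hol_tangent M)"
    and "V \<in> sections M (antihol_tangent M) \<Longrightarrow> nabla M \<nu> U V \<in> sections M (antihol_tangent M)"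
  using nabla_section[OF U] hol_section_ctangent D_flat_hol_proj[OF _ U] nabla_hol[OF _ U]
    nabla_antihol[OF _ U]
  by (auto simp: sections_def)

theorem nabla_metric:
  assumes U: "U \<in> sections M (ctangent_space M)" and V: "V \<in> sections M (ctangent_space M)"
    and W: "W \<in> sections M (ctangent_space M)" and p: "p \<in> M"
  shows "cov_deriv_g M (nabla M \<nu>) U V W p = 0"
proof -
  have g_T: "q \<in> M \<Longrightarrow> v \<in> hol_tangent M q \<Longrightarrow> g (T_field \<nu> q) v = 0"
    "q \<in> M \<Longrightarrow> v \<in> antihol_tangent M q \<Longrightarrow> g (T_field \<nu> q) v = 0" for q v
    using g_hol_T g_antihol_T by (simp_all add: g_commute[of "T_field \<nu> q" v])
  obtain Z B f where ZBf: "Z \<in> sections M (hol_tangent M)" "B \<in> sections M (antihol_tangent M)"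
    "smooth_along M f" and dec: "\<And>q. q \<in> M \<Longrightarrow> V q = Z q + B q + f q *\<^sub>c T_field \<nu> q"
    using decomposition[OF V] by blast
  obtain Z' B' f' where ZBf': "Z' \<in> sections M (hol_tangent M)" "B' \<in> sections M (antihol_tangent M)"
    "smooth_along M f'" and dec': "\<And>q. q \<in> M \<Longrightarrow> W q = Z' q + B' q + f' q *\<^sub>c T_field \<nu> q"
    using decomposition[OF W] by blast
  have u: "U p \<in> ctangent_space M p" using U p by (simp add: sections_def)
  have sm: "smooth_along M Z" "smooth_along M B" "smooth_along M Z'" "smooth_along M B'"
    "smooth_along M V" "smooth_along M W"
    using ZBf ZBf' V W by (auto simp: sections_def)
  have hol: "g z z' = 0" if "q \<in> M" "z \<in> hol_tangent M q" "z' \<in> hol_tangent M q" for q z z'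
    using that by (simp add: hol_tangent_iff g_type10_type10)
  have antihol: "g w w' = 0"
    if "q \<in> M" "w \<in> antihol_tangent M q" "w' \<in> antihol_tangent M q" for q w w'
    using that by (simp add: antihol_tangent_iff hol_tangent_iff g_type01_type01)
  \<comment> \<open>Of the nine products only those between opposite types and T with T
    survive.\<close>
  have expand: "g (z + w + c *\<^sub>c T_field \<nu> q) (z' + w' + c' *\<^sub>c T_field \<nu> q) = g z w' + g w z' + c * c'"
    if "q \<in> M" "z \<in> hol_tangent M q" "z' \<in> hol_tangent M q" "w \<in> antihol_tangent M q"
      "w' \<in> antihol_tangent M q" for q z z' w w' c c'
    using that by (simp add: g_simps g_T g_hol_T g_antihol_T g_T_T hol antihol)
  \<comment> \<open>The subtracted multiples of N and its conjugate are orthogonal to all tangent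
    vectors of either type, so the projections disappear inside \<open>g\<close>.\<close>
  have proj: "g (hol_proj \<nu> p v) w = g v w" "g (antihol_proj \<nu> p v) z = g v z"
    if "z \<in> hol_tangent M p" "w \<in> antihol_tangent M p" for v z w
  proof -
    have z: "g (N_field \<nu> p) z = 0" "g (cvec_cnj (N_field \<nu> p)) z = 0"
      if z: "z \<in> hol_tangent M p" for z
    proof -
      have "g z (cvec_of_real (\<nu> p)) = 0" "g z (N_field \<nu> p) = 0"
        using z p g_type10_type10[OF _ N_field_type10, of z \<nu> p] by (simp_all add: hol_tangent_iff)
      then show "g (N_field \<nu> p) z = 0" "g (cvec_cnj (N_field \<nu> p)) z = 0"
        by (simp_all add: normal_eq_N_field g_simps g_commute[of _ z])
    qed
    have "g (N_field \<nu> p) w = 0"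
      using z(2)[of "cvec_cnj w"] that(2) g_cnj_cnj[of "N_field \<nu> p" w] by (simp add: antihol_tangent_iff)
    with z(2)[OF that(1)] show "g (hol_proj \<nu> p v) w = g v w" "g (antihol_proj \<nu> p v) z = g v z"
      by (simp_all add: hol_proj_def antihol_proj_def g_simps)
  qed
  have ZBp: "Z q \<in> hol_tangent M q" "B q \<in> antihol_tangent M q" "Z' q \<in> hol_tangent M q"
    "B' q \<in> antihol_tangent M q" if "q \<in> M" for q
    using ZBf ZBf' that by (auto simp: sections_def)
  have nabla_V: "nabla M \<nu> U V p = hol_proj \<nu> p (D_flat M U Z p) +
      antihol_proj \<nu> p (D_flat M U B p) + app_field M U f p *\<^sub>c T_field \<nu> p"
    by (rule nabla_decomposition[OF p U ZBf dec])
  have nabla_W: "nabla M \<nu> U W p = hol_proj \<nu> p (D_flat M U Z' p) +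
      antihol_proj \<nu> p (D_flat M U B' p) + app_field M U f' p *\<^sub>c T_field \<nu> p"
    by (rule nabla_decomposition[OF p U ZBf' dec'])
  have eq: "g (V q) (W q) = g (Z q) (B' q) + g (B q) (Z' q) + f q * f' q" if "q \<in> M" for q
    unfolding dec[OF that] dec'[OF that] by (rule expand) (use that ZBp in auto)
  have "app_field M U (\<lambda>q. g (V q) (W q)) p =
      fun_deriv M (U p) (\<lambda>q. g (Z q) (B' q) + g (B q) (Z' q) + f q * f' q) p"
    unfolding app_field_def by (rule fun_deriv_cong[OF p u smooth_g[OF sm(5,6)] eq])
  also have "\<dots> = g (D_flat M U Z p) (B' p) + g (Z p) (D_flat M U B' p) +
      (g (D_flat M U B p) (Z' p) + g (B p) (D_flat M U Z' p)) +
      (f p * app_field M U f' p + app_field M U f p * f' p)"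
    using sm ZBf(3) ZBf'(3)
    by (simp add: D_flat_def app_field_def fun_deriv_add[OF p u] fun_deriv_g[OF p u]
        fun_deriv_mult[OF p u] smooth_g smooth_mult smooth_along_add)
  also have "\<dots> = g (nabla M \<nu> U V p) (W p) + g (V p) (nabla M \<nu> U W p)"
    unfolding nabla_V nabla_W dec[OF p] dec'[OF p] expand[OF p D_flat_hol_proj(3)[OF p U ZBf(1)] ZBp(3)[OF p]
        D_flat_hol_proj(4)[OF p U ZBf(2)] ZBp(4)[OF p]]
      expand[OF p ZBp(1)[OF p] D_flat_hol_proj(3)[OF p U ZBf'(1)]
        ZBp(2)[OF p] D_flat_hol_proj(4)[OF p U ZBf'(2)]]
    using proj ZBp[OF p] by (simp add: g_commute[of "Z p"] g_commute[of "B p"])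
  finally show ?thesis by (simp add: cov_deriv_g_def)
qed

text \<open>The bracket has type (1,0) because both flat derivatives do, and it is tangent, so the
  projection fixes it; the torsion is the projected bracket minus the bracket.\<close>

theorem torsion_hol_hol:
  assumes U: "U \<in> sections M (hol_tangent M)" and V: "V \<in> sections M (hol_tangent M)"
    and p: "p \<in> M"
  shows "torsion M (nabla M \<nu>) U V p = 0"
proof -
  note U' = hol_section_ctangent(1)[OF U] and V' = hol_section_ctangent(1)[OF V]
  let ?w = "D_flat M U V p - D_flat M V U p"
  have "?w \<in> type10"
    using D_flat_hol_proj(1)[OF p U' V] D_flat_hol_proj(1)[OF p V' U]
    by (simp add: type10_iff J_diff cvec.scale_right_diff_distrib)
  then have "?w \<in> hol_tangent M p"
    using lie_bracket_eq(2)[OF p U' V'] by (simp add: hol_tangent_def)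
  then have "hol_proj \<nu> p ?w = ?w" by (rule hol_proj_hol(1)[OF p])
  moreover have "hol_proj \<nu> p (D_flat M U V p) = hol_proj \<nu> p ?w + hol_proj \<nu> p (D_flat M V U p)"
    by (simp flip: hol_proj_add)
  ultimately show ?thesis
    by (simp add: torsion_def nabla_hol[OF p U' V] nabla_hol[OF p V' U] lie_bracket_eq(1)[OF p U' V'])
qed

theorem torsion_hol_antihol:
  assumes U: "U \<in> sections M (hol_tangent M)" and V: "V \<in> sections M (hol_tangent M)"
    and p: "p \<in> M"
  shows "torsion M (nabla M \<nu>) U (\<lambda>q. cvec_cnj (V q)) p =
    - (g (lie_bracket M U (\<lambda>q. cvec_cnj (V q)) p) (T_field \<nu> p) *\<^sub>c T_field \<nu> p)"
proof -
  let ?V = "\<lambda>q. cvec_cnj (V q)"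
  have V: "?V \<in> sections M (antihol_tangent M)" by (rule cvec_cnj_section(2)[OF V])
  note U' = hol_section_ctangent(1)[OF U] and V' = hol_section_ctangent(2)[OF V]
  let ?a = "D_flat M U ?V p" and ?b = "D_flat M ?V U p"
  let ?N = "N_field \<nu> p" and ?T = "T_field \<nu> p" and ?s = "complex_of_real (1 / sqrt 2)"
  \<comment> \<open>By type each of the two derivatives has one vanishing product, so
    \<open>g ?a ?N\<close> and \<open>g ?b (cvec_cnj ?N)\<close> can be read off from the bracket
    \<open>?a - ?b\<close> alone.\<close>
  have aN: "g ?a (cvec_cnj ?N) = 0"
    using D_flat_hol_proj(2)[OF p U' V] N_field_type10[of \<nu> p] by (simp add: g_type01_type01)
  have bN: "g ?b ?N = 0"
    by (rule g_type10_type10[OF D_flat_hol_proj(1)[OF p V' U] N_field_type10])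
  have "g (?a - ?b) (cvec_of_real (\<nu> p)) = 0"
    using lie_bracket_eq(2)[OF p U' V'] p by (simp add: ctangent_space_iff)
  \<comment> \<open>Inserting N = (\<nu> - i T) / sqrt 2 and its conjugate: the \<nu> part drops out
    by tangency of the bracket.\<close>
  then have wN: "g (?a - ?b) ?N = - (?s * (\<i> * g (?a - ?b) ?T))"
    "g (?a - ?b) (cvec_cnj ?N) = ?s * (\<i> * g (?a - ?b) ?T)"
    unfolding cvec_cnj_N_field unfolding N_field_def
    by (simp_all only: g_scale_right g.diff_right g.add_right) simp_all
  then have "g ?a ?N = - (?s * (\<i> * g (?a - ?b) ?T))" "g ?b (cvec_cnj ?N) = - (?s * (\<i> * g (?a - ?b) ?T))"
    using aN bN by (simp_all only: g.diff_left) (simp_all add: algebra_simps)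
  \<comment> \<open>The flat derivatives cancel against the bracket; what remains is
    \<open>- g ?a ?N\<close> times conj N plus \<open>g ?b (cvec_cnj ?N)\<close> times N, with equal
    products in both.\<close>
  then have "torsion M (nabla M \<nu>) U ?V p = (?s * (\<i> * g (?a - ?b) ?T)) *\<^sub>c (cvec_cnj ?N - ?N)"
    by (simp add: torsion_def nabla_antihol[OF p U' V] nabla_hol[OF p V' U]
        lie_bracket_eq(1)[OF p U' V'] hol_proj_def antihol_proj_def cvec.scale_right_diff_distrib
        del: of_real_divide)
  also have "cvec_cnj ?N - ?N = (?s * (2 * \<i>)) *\<^sub>c ?T"
  proof -
    have "v + w - (v - w) = 2 *\<^sub>c w" for v w :: "'m cvec"
      by (simp add: prod_eq_iff scaleR_2)
    then show ?thesis
      unfolding cvec_cnj_N_field unfolding N_field_def cvec.scale_right_diff_distrib[symmetric]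
      by (simp only: cvec.scale_scale mult.assoc)
  qed
  also have "(?s * (\<i> * g (?a - ?b) ?T)) *\<^sub>c ((?s * (2 * \<i>)) *\<^sub>c ?T) = - (g (?a - ?b) ?T *\<^sub>c ?T)"
  proof -
    have "(?s * (\<i> * c)) * (?s * (2 * \<i>)) = - c" for c
      using inv_sqrt2_squared[of "- 2 * c"] by (simp add: algebra_simps del: of_real_divide)
    then show ?thesis by (simp only: cvec.scale_scale cvec.scale_minus_left)
  qed
  finally show ?thesis by (simp add: lie_bracket_eq(1)[OF p U' V'])
qed

end

theorem theorem3p1:
  fixes M :: "(complex ^ 'm::finite) set"
    and \<nu> :: "complex ^ 'm \<Rightarrow> complex ^ 'm"
    and n :: nat
  assumes "n \<ge> 1"
    and "CARD('m) = n + 1"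
    and "smooth_hypersurface M"
    and "unit_normal_field M \<nu>"
  shows "complex_connection M (nabla M \<nu>)
    \<and> \<comment> \<open>C1\<close>
      (\<forall>U \<in> sections M (ctangent_space M). \<forall>V \<in> sections M (ctangent_space M). \<forall>p\<in>M.
        cvec_cnj (nabla M \<nu> U V p) = nabla M \<nu> (\<lambda>q. cvec_cnj (U q)) (\<lambda>q. cvec_cnj (V q)) p)
    \<and> \<comment> \<open>C2\<close>
      (\<forall>U \<in> sections M (ctangent_space M). \<forall>V \<in> sections M (levi_distribution M). \<forall>p\<in>M.
        nabla M \<nu> U (\<lambda>q. J (V q)) p = J (nabla M \<nu> U V p))
    \<and> \<comment> \<open>C3\<close>
      (\<forall>U \<in> sections M (ctangent_space M).
        (\<forall>V \<in> sections M (hol_tangent M). nabla M \<nu> U V \<in> sections M (hol_tangent M)) \<and>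
        (\<forall>V \<in> sections M (antihol_tangent M). nabla M \<nu> U V \<in> sections M (antihol_tangent M)))
    \<and> \<comment> \<open>C4\<close>
      (\<forall>U \<in> sections M (ctangent_space M). \<forall>V \<in> sections M (ctangent_space M).
        \<forall>W \<in> sections M (ctangent_space M). \<forall>p\<in>M. cov_deriv_g M (nabla M \<nu>) U V W p = 0)
    \<and> \<comment> \<open>C5\<close>
      (\<forall>U \<in> sections M (hol_tangent M). \<forall>V \<in> sections M (hol_tangent M). \<forall>p\<in>M.
        torsion M (nabla M \<nu>) U V p = 0)
    \<and> \<comment> \<open>C6\<close>
      (\<forall>U \<in> sections M (hol_tangent M). \<forall>V \<in> sections M (hol_tangent M). \<forall>p\<in>M.
        torsion M (nabla M \<nu>) U (\<lambda>q. cvec_cnj (V q)) p =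
          - (g (lie_bracket M U (\<lambda>q. cvec_cnj (V q)) p) (T_field \<nu> p) *\<^sub>c T_field \<nu> p))"
proof -
  interpret oriented_complex_hypersurface M \<nu>
    using assms(3,4) by unfold_locales
  show ?thesis
    by (intro conjI ballI complex_connection_nabla nabla_cnj nabla_J nabla_parallel nabla_metric
        torsion_hol_hol torsion_hol_antihol)
qed

end
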